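(* Let $X$ be a Banach space with property $(\mathbb{A})$. Then the Banach algebra $\mathcal{A}(X)$ is strongly zero product determined. Specifically, if $C=\sup_{\lambda\in\Lambda}\sup_{t\in G_\lambda}\Vert\theta_\lambda(t)\Vert$ is the (finite) supremum associated with data $\Lambda$, $\theta_\lambda$, $G_\lambda$ ($\lambda\in\Lambda$) witnessing property $(\mathbb{A})$ of $X$, then $$\tfrac{1}{2}\beta_{\mathcal{A}(X)}\le\alpha_{\mathcal{A}(X)}\le 60\sqrt{27}\,\frac{1+\sin\frac{\pi}{10}}{1-2\sin\frac{\pi}{10}}\,C^2.$$
   Context: All spaces and algebras are over $\mathbb{C}$. Operators. For a Banach space $X$ with dual $X^*$, $\mathcal{B}(X)$ is the Banach algebra of continuous linear operators on $X$, $\mathcal{F}(X)$ the ideal of finite-rank operators, and $\mathcal{A}(X)$ (the approximable operators) the closure of $\mathcal{F}(X)$ in $\mathcal{B}(X)$ in the operator norm. $I_X$, $I_{X^*}$ are the identity operators. For $x\in X$, $\phi\in X^*$, $x\otimes\phi\in\mathcal{F}(X)$ is $(x\otimes\phi)(y)=\phi(y)x$. A finite, biorthogonal system for $X$ is a set $\{(x_j,\phi_k): j,k=1,\ldots,n\}$ with $x_1,\ldots,x_n\in X$, $\phi_1,\ldots,\phi_n\in X^*$ and $\phi_k(x_j)=\delta_{j,k}$ for all $j,k$. Such a system defines an algebra homomorphism $\theta\colon\mathbb{M}_n\to\mathcal{F}(X)$, $(a_{j,k})\mapsto\sum_{j,k=1}^n a_{j,k}\,x_j\otimes\phi_k$,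 where $\mathbb{M}_n$ is the algebra of complex $n\times n$ matrices, with identity $I_n$. Property $(\mathbb{A})$. $X$ has property $(\mathbb{A})$ if there is a directed set $\Lambda$ such that, for each $\lambda\in\Lambda$, there is a finite, biorthogonal system $\{(x_j^\lambda,\phi_k^\lambda): j,k=1,\ldots,n_\lambda\}$ for $X$ with corresponding algebra homomorphism $\theta_\lambda\colon\mathbb{M}_{n_\lambda}\to\mathcal{F}(X)$ such that: (i) $\lim_{\lambda\in\Lambda}\theta_\lambda(I_{n_\lambda})=I_X$ uniformly on compact subsets of $X$; (ii) $\lim_{\lambda\in\Lambda}\theta_\lambda(I_{n_\lambda})^*=I_{X^*}$ uniformly on compact subsets of $X^*$; (iii) for each $\lambda\in\Lambda$ there is a finite subgroup $G_\lambda$ of the group of all invertible complex $n_\lambda\times n_\lambda$ matrices whose linear span is all of $\mathbb{M}_{n_\lambda}$, such that $\sup_{\lambda\in\Lambda}\sup_{t\in G_\lambda}\Vert\theta_\lambda(t)\Vert<\infty$. Zero product notions. Let $A$ be a Banach algebra, $\pi\colon A\times A\to A$, $\pi(a,b)=ab$, its product map, $A^*$ its dual, and $\mathcal{B}^2(A;\mathbb{C})$ the space of continuous bilinear functionals $\varphi\colon A\times A\to\mathbb{C}$ with the norm $\Vert\varphi\Vert=\sup\{|\varphi(a,b)| : \Vert a\Vert=\Vert b\Vert=1\}$. Set $\mathcal{B}^2_\pi(A;\mathbb{C})=\{\xi\circ\pi : \xi\in A^*\}$. For $\varphi\in\mathcal{B}^2(A;\mathbb{C})$ put $$\operatorname{dist}(\varphi,\mathcal{B}^2_\pi(A;\mathbb{C}))=\inf\{\Vert\varphi-\psi\Vert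 : \psi\in\mathcal{B}^2_\pi(A;\mathbb{C})\},$$ $$|\varphi|_b=\sup\{|\varphi(ab,c)-\varphi(a,bc)| : a,b,c\in A,\ \Vert a\Vert=\Vert b\Vert=\Vert c\Vert=1\},$$ $$|\varphi|_{zp}=\sup\{|\varphi(a,b)| : a,b\in A,\ \Vert a\Vert=\Vert b\Vert=1,\ ab=0\},$$ with the convention $\sup\varnothing=0$. $A$ is called strongly zero product determined if there is a constant $\alpha\ge 0$ with $\operatorname{dist}(\varphi,\mathcal{B}^2_\pi(A;\mathbb{C}))\le\alpha|\varphi|_{zp}$ for all $\varphi\in\mathcal{B}^2(A;\mathbb{C})$; the optimal (smallest) such $\alpha\ge 0$ is denoted $\alpha_A$. $A$ has the strong property $\mathbb{B}$ if there is a constant $\beta\ge 0$ with $|\varphi|_b\le\beta|\varphi|_{zp}$ for all $\varphi\in\mathcal{B}^2(A;\mathbb{C})$; the optimal (smallest) such $\beta\ge 0$ is denoted $\beta_A$. The inequality involving $\beta_{\mathcal{A}(X)}$ includes the assertion that $\mathcal{A}(X)$ has the strong property $\mathbb{B}$. *)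

theory Defs
  imports "HOL-Analysis.Analysis" "Jordan_Normal_Form.Matrix"
begin

section \<open>Complex Banach spaces and algebras\<close>

text \<open>
  The distribution only has real normed spaces. The classes below extend them by a complex scalar
  multiplication that restricts to the given real one.
\<close>

class scaleC =
  fixes scaleC :: "complex \<Rightarrow> 'a \<Rightarrow> 'a"  (infixr \<open>*\<^sub>C\<close> 75)

class complex_vector = real_vector + scaleC +
  assumes scaleC_add_right: "a *\<^sub>C (x + y) = a *\<^sub>C x + a *\<^sub>C y"
    and scaleC_add_left: "(a + b) *\<^sub>C x = a *\<^sub>C x + b *\<^sub>C x"
    and scaleC_scaleC: "a *\<^sub>C (b *\<^sub>C x) = (a * b) *\<^sub>C x"
    and scaleC_one: "1 *\<^sub>C x = x"
    and scaleR_scaleC: "r *\<^sub>R x = complex_of_real r *\<^sub>C x"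

class complex_normed_vector = complex_vector + real_normed_vector +
  assumes norm_scaleC: "norm (a *\<^sub>C x) = cmod a * norm x"

class cbanach = complex_normed_vector + banach

text \<open>A Banach algebra is not required to have a unit; the norm is submultiplicative.\<close>

class complex_normed_algebra = complex_normed_vector + real_normed_algebra +
  assumes mult_scaleC_left: "(c *\<^sub>C x) * y = c *\<^sub>C (x * y)"
    and mult_scaleC_right: "x * (c *\<^sub>C y) = c *\<^sub>C (x * y)"

class cbanach_algebra = complex_normed_algebra + cbanach

global_interpretation complex_vector: vector_space "scaleC :: complex \<Rightarrow> 'a \<Rightarrow> 'a::complex_vector"
  by unfold_locales
    (simp_all add: scaleC_add_right scaleC_add_left scaleC_scaleC scaleC_one)

instantiation complex :: cbanach
begin

definition scaleC_complex :: "complex \<Rightarrow> complex \<Rightarrow> complex"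
  where "scaleC_complex c x = c * x"

instance
  by standard (simp_all add: scaleC_complex_def algebra_simps norm_mult scaleR_conv_of_real)

end

lemma bounded_linear_scaleC_right:
  "bounded_linear (\<lambda>x::'a::complex_normed_vector. c *\<^sub>C x)"
proof (rule bounded_linear_intro)
  fix r :: real and x :: 'a
  show "c *\<^sub>C r *\<^sub>R x = r *\<^sub>R c *\<^sub>C x"
    by (simp add: scaleR_scaleC scaleC_scaleC mult.commute)
  show "norm (c *\<^sub>C x) \<le> norm x * cmod c"
    by (simp add: norm_scaleC mult.commute)
qed (simp add: scaleC_add_right)

lemma bounded_linear_scaleC_left:
  "bounded_linear (\<lambda>c. c *\<^sub>C (x::'a::complex_normed_vector))"
proof (rule bounded_linear_intro)
  fix r :: real and c :: complex
  show "(r *\<^sub>R c) *\<^sub>C x = r *\<^sub>R c *\<^sub>C x"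
    by (simp only: scaleR_scaleC[of r x] scaleR_scaleC[of r "c *\<^sub>C x"] scaleC_scaleC scaleR_conv_of_real)
  show "norm (c *\<^sub>C x) \<le> norm c * norm x"
    by (simp add: norm_scaleC)
qed (simp add: scaleC_add_left)


section \<open>Complex-linear operators\<close>

definition clinear :: "('a::complex_vector \<Rightarrow> 'b::complex_vector) \<Rightarrow> bool"
  where "clinear f \<longleftrightarrow> (\<forall>x y. f (x + y) = f x + f y) \<and> (\<forall>c x. f (c *\<^sub>C x) = c *\<^sub>C f x)"

text \<open>
  Elements of the library type of bounded operators are only real-linear. The bounded complex-linear
  operators are the subset \<open>cblinfuns\<close>; the norm of \<open>blinfun\<close> is the usual operator norm on it.
  In particular \<open>cblinfuns :: ('a \<Rightarrow>\<^sub>L 'a) set\<close> is the algebra of bounded operators on the space,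
  and \<open>cblinfuns :: ('a \<Rightarrow>\<^sub>L complex) set\<close> is its dual.
\<close>

definition cblinfuns :: "('a::complex_normed_vector \<Rightarrow>\<^sub>L 'b::complex_normed_vector) set"
  where "cblinfuns = {T. clinear (blinfun_apply T)}"

definition finite_rank_ops :: "('a::complex_normed_vector \<Rightarrow>\<^sub>L 'b::complex_normed_vector) set"
  where "finite_rank_ops =
    {T \<in> cblinfuns. \<exists>S. finite S \<and> range (blinfun_apply T) \<subseteq> complex_vector.span S}"

instantiation blinfun :: (real_normed_vector, complex_normed_vector) complex_normed_vector
begin

lift_definition scaleC_blinfun :: "complex \<Rightarrow> ('a \<Rightarrow>\<^sub>L 'b) \<Rightarrow> ('a \<Rightarrow>\<^sub>L 'b)"
  is "\<lambda>c f x. c *\<^sub>C f x"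
  by (rule bounded_linear_compose[OF bounded_linear_scaleC_right])

instance
proof
  fix T S :: "'a \<Rightarrow>\<^sub>L 'b" and a b :: complex and r :: real
  show "a *\<^sub>C (T + S) = a *\<^sub>C T + a *\<^sub>C S"
    by transfer (simp add: scaleC_add_right)
  show "(a + b) *\<^sub>C T = a *\<^sub>C T + b *\<^sub>C T"
    by transfer (simp add: scaleC_add_left)
  show "a *\<^sub>C (b *\<^sub>C T) = (a * b) *\<^sub>C T"
    by transfer (simp add: scaleC_scaleC)
  show "1 *\<^sub>C T = T"
    by transfer (simp add: scaleC_one)
  show "r *\<^sub>R T = complex_of_real r *\<^sub>C T"
    by transfer (simp add: scaleR_scaleC)
  have le: "norm (c *\<^sub>C U) \<le> cmod c * norm U" for c and U :: "'a \<Rightarrow>\<^sub>L 'b"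
  proof (rule norm_blinfun_bound)
    fix x
    have "norm (blinfun_apply (c *\<^sub>C U) x) = cmod c * norm (U x)"
      by (simp add: scaleC_blinfun.rep_eq norm_scaleC)
    also have "\<dots> \<le> cmod c * (norm U * norm x)"
      by (intro mult_left_mono norm_blinfun) simp
    finally show "norm (blinfun_apply (c *\<^sub>C U) x) \<le> cmod c * norm U * norm x"
      by (simp add: mult.assoc)
  qed simp
  show "norm (a *\<^sub>C T) = cmod a * norm T"
  proof (cases "a = 0")
    case True
    with le[of a T] show ?thesis by simp
  next
    case False
    have "T = inverse a *\<^sub>C (a *\<^sub>C T)"
      using False by transfer (simp add: scaleC_scaleC scaleC_one)
    then have "norm T \<le> inverse (cmod a) * norm (a *\<^sub>C T)"
      by (metis le norm_inverse)
    then have "cmod a * norm T \<le> norm (a *\<^sub>C T)"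
      using False by (simp add: field_simps)
    with le[of a T] show ?thesis by simp
  qed
qed

end

instance blinfun :: (real_normed_vector, cbanach) cbanach ..

lift_definition rank_one :: "'a::complex_normed_vector \<Rightarrow> ('a \<Rightarrow>\<^sub>L complex) \<Rightarrow> ('a \<Rightarrow>\<^sub>L 'a)"
  is "\<lambda>x \<phi> y. \<phi> y *\<^sub>C x"
  by (rule bounded_linear_compose[OF bounded_linear_scaleC_left])


section \<open>The Banach algebra of approximable operators\<close>

lemma finite_rank_ops_zero: "0 \<in> finite_rank_ops"
proof -
  have "range (blinfun_apply (0 :: 'a \<Rightarrow>\<^sub>L 'b)) \<subseteq> complex_vector.span {}" by auto
  then show ?thesis
    unfolding finite_rank_ops_def cblinfuns_def clinear_def by auto
qed

lemma finite_rank_ops_add: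
  assumes "T \<in> finite_rank_ops" "U \<in> finite_rank_ops"
  shows "T + U \<in> finite_rank_ops"
proof -
  obtain A B where A: "finite A" "range (blinfun_apply T) \<subseteq> complex_vector.span A"
    and B: "finite B" "range (blinfun_apply U) \<subseteq> complex_vector.span B"
    using assms unfolding finite_rank_ops_def by auto
  have "complex_vector.span A \<subseteq> complex_vector.span (A \<union> B)"
    "complex_vector.span B \<subseteq> complex_vector.span (A \<union> B)"
    by (auto intro: complex_vector.span_mono[THEN subsetD, rotated])
  then have "range (blinfun_apply (T + U)) \<subseteq> complex_vector.span (A \<union> B)"
    using A B by (auto simp: plus_blinfun.rep_eq intro!: complex_vector.span_add)
  moreover have "finite (A \<union> B)" using A B by simp
  moreover have "T + U \<in> cblinfuns"
    using assms unfolding finite_rank_ops_def cblinfuns_def clinear_def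
    by (auto simp: plus_blinfun.rep_eq scaleC_add_right)
  ultimately show ?thesis unfolding finite_rank_ops_def by blast
qed

lemma finite_rank_ops_scaleC:
  assumes "T \<in> finite_rank_ops"
  shows "c *\<^sub>C T \<in> finite_rank_ops"
proof -
  obtain A where A: "finite A" "range (blinfun_apply T) \<subseteq> complex_vector.span A"
    using assms unfolding finite_rank_ops_def by auto
  then have "range (blinfun_apply (c *\<^sub>C T)) \<subseteq> complex_vector.span A"
    by (auto simp: scaleC_blinfun.rep_eq intro!: complex_vector.span_scale)
  moreover have "c *\<^sub>C T \<in> cblinfuns"
    using assms unfolding finite_rank_ops_def cblinfuns_def clinear_def
    by (auto simp: scaleC_blinfun.rep_eq scaleC_add_right scaleC_scaleC mult.commute)
  ultimately show ?thesis using A unfolding finite_rank_ops_def by blast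
qed

lemma finite_rank_ops_compose:
  assumes "T \<in> finite_rank_ops" "U \<in> finite_rank_ops"
  shows "T o\<^sub>L U \<in> finite_rank_ops"
proof -
  obtain A where A: "finite A" "range (blinfun_apply T) \<subseteq> complex_vector.span A"
    using assms unfolding finite_rank_ops_def by auto
  then have "range (blinfun_apply (T o\<^sub>L U)) \<subseteq> complex_vector.span A" by auto
  moreover have "T o\<^sub>L U \<in> cblinfuns"
    using assms unfolding finite_rank_ops_def cblinfuns_def clinear_def by auto
  ultimately show ?thesis using A unfolding finite_rank_ops_def by blast
qed

text \<open>
  The set \<open>cblinfuns\<close> is closed, so it does not matter whether the closure is taken there or among
  all real-linear bounded operators.
\<close>

lemma closed_cblinfuns: "closed (cblinfuns :: ('a::complex_normed_vector \<Rightarrow>\<^sub>L 'b::complex_normed_vector) set)"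
proof -
  have eq: "cblinfuns = (\<Inter>c x. {T :: 'a \<Rightarrow>\<^sub>L 'b. blinfun_apply T (c *\<^sub>C x) = c *\<^sub>C blinfun_apply T x})"
    unfolding cblinfuns_def clinear_def by (auto simp: blinfun.add_right)
  have "closed {T :: 'a \<Rightarrow>\<^sub>L 'b. blinfun_apply T (c *\<^sub>C x) = c *\<^sub>C blinfun_apply T x}" for c x
  proof (rule closed_Collect_eq)
    show "continuous_on UNIV (\<lambda>T :: 'a \<Rightarrow>\<^sub>L 'b. blinfun_apply T (c *\<^sub>C x))"
      by (intro continuous_intros)
    show "continuous_on UNIV (\<lambda>T :: 'a \<Rightarrow>\<^sub>L 'b. c *\<^sub>C blinfun_apply T x)"
      by (intro bounded_linear.continuous_on[OF bounded_linear_scaleC_right] continuous_intros)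
  qed
  then show ?thesis unfolding eq by (intro closed_INT) auto
qed

definition approximable_ops :: "('a::complex_normed_vector \<Rightarrow>\<^sub>L 'b::complex_normed_vector) set"
  where "approximable_ops = closure finite_rank_ops"

lemma approximable_ops_subset: "approximable_ops \<subseteq> cblinfuns"
  unfolding approximable_ops_def
  by (rule closure_minimal) (auto simp: finite_rank_ops_def closed_cblinfuns)

lemma approximable_ops_zero: "0 \<in> approximable_ops"
  unfolding approximable_ops_def using closure_subset finite_rank_ops_zero by blast

lemma approximable_ops_add:
  "T \<in> approximable_ops \<Longrightarrow> U \<in> approximable_ops \<Longrightarrow> T + U \<in> approximable_ops"
  unfolding approximable_ops_def closure_sequential
  apply (elim exE conjE)
  subgoal for f g
    by (rule exI[of _ "\<lambda>n. f n + g n"]) (simp add: tendsto_add finite_rank_ops_add)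
  done

lemma approximable_ops_scaleC:
  "T \<in> approximable_ops \<Longrightarrow> c *\<^sub>C T \<in> approximable_ops"
  unfolding approximable_ops_def closure_sequential
  apply (elim exE conjE)
  subgoal for f
    by (rule exI[of _ "\<lambda>n. c *\<^sub>C f n"])
      (simp add: bounded_linear.tendsto[OF bounded_linear_scaleC_right] finite_rank_ops_scaleC)
  done

lemma approximable_ops_scaleR:
  "T \<in> approximable_ops \<Longrightarrow> r *\<^sub>R T \<in> approximable_ops"
  by (simp add: scaleR_scaleC approximable_ops_scaleC)

lemma approximable_ops_uminus:
  "T \<in> approximable_ops \<Longrightarrow> - T \<in> approximable_ops"
  using approximable_ops_scaleR[of T "-1"] by simp

lemma approximable_ops_diff:
  "T \<in> approximable_ops \<Longrightarrow> U \<in> approximable_ops \<Longrightarrow> T - U \<in> approximable_ops"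
  using approximable_ops_add[of T "- U"] approximable_ops_uminus[of U] by simp

lemma approximable_ops_compose:
  "T \<in> approximable_ops \<Longrightarrow> U \<in> approximable_ops \<Longrightarrow> T o\<^sub>L U \<in> approximable_ops"
  unfolding approximable_ops_def closure_sequential
  apply (elim exE conjE)
  subgoal for f g
    by (rule exI[of _ "\<lambda>n. f n o\<^sub>L g n"])
      (simp add: bounded_bilinear.tendsto[OF bounded_bilinear_blinfun_compose] finite_rank_ops_compose)
  done

typedef (overloaded) 'a approximable = "approximable_ops :: ('a::cbanach \<Rightarrow>\<^sub>L 'a) set"
  morphisms approx_op Abs_approximable
  using approximable_ops_zero by blast

setup_lifting type_definition_approximable

instantiation approximable :: (cbanach) real_normed_vector
begin

lift_definition zero_approximable :: "'a approximable" is 0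
  by (rule approximable_ops_zero)
lift_definition plus_approximable :: "'a approximable \<Rightarrow> 'a approximable \<Rightarrow> 'a approximable" is "(+)"
  by (rule approximable_ops_add)
lift_definition minus_approximable :: "'a approximable \<Rightarrow> 'a approximable \<Rightarrow> 'a approximable" is "(-)"
  by (rule approximable_ops_diff)
lift_definition uminus_approximable :: "'a approximable \<Rightarrow> 'a approximable" is uminus
  by (rule approximable_ops_uminus)
lift_definition scaleR_approximable :: "real \<Rightarrow> 'a approximable \<Rightarrow> 'a approximable" is scaleR
  by (rule approximable_ops_scaleR)
lift_definition norm_approximable :: "'a approximable \<Rightarrow> real" is norm .

definition dist_approximable :: "'a approximable \<Rightarrow> 'a approximable \<Rightarrow> real"
  where "dist_approximable T U = norm (T - U)"
definition
  "(uniformity :: ('a approximable \<times> 'a approximable) filter) =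
    (INF e\<in>{0 <..}. principal {(x, y). dist x y < e})"
definition open_approximable :: "'a approximable set \<Rightarrow> bool"
  where "open_approximable S =
    (\<forall>x\<in>S. \<forall>\<^sub>F (x', y) in uniformity. x' = x \<longrightarrow> y \<in> S)"
definition sgn_approximable :: "'a approximable \<Rightarrow> 'a approximable"
  where "sgn_approximable T = scaleR (inverse (norm T)) T"

instance
proof
  fix T U V :: "'a approximable" and r s :: real
  show "dist T U = norm (T - U)" by (rule dist_approximable_def)
  show "sgn T = scaleR (inverse (norm T)) T" by (rule sgn_approximable_def)
  show "T + U + V = T + (U + V)" by transfer (simp add: algebra_simps)
  show "T + U = U + T" by transfer (simp add: algebra_simps)
  show "0 + T = T" by transfer simp
  show "- T + T = 0" by transfer simp
  show "T - U = T + - U" by transfer simp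
  show "r *\<^sub>R (T + U) = r *\<^sub>R T + r *\<^sub>R U" by transfer (simp add: algebra_simps)
  show "(r + s) *\<^sub>R T = r *\<^sub>R T + s *\<^sub>R T" by transfer (simp add: algebra_simps)
  show "r *\<^sub>R s *\<^sub>R T = (r * s) *\<^sub>R T" by transfer simp
  show "1 *\<^sub>R T = T" by transfer simp
  show "norm T = 0 \<longleftrightarrow> T = 0" by transfer simp
  show "norm (T + U) \<le> norm T + norm U" by transfer (rule norm_triangle_ineq)
  show "norm (r *\<^sub>R T) = \<bar>r\<bar> * norm T" by transfer simp
qed (simp_all only: uniformity_approximable_def open_approximable_def)

end

instantiation approximable :: (cbanach) complex_normed_vector
begin

lift_definition scaleC_approximable :: "complex \<Rightarrow> 'a approximable \<Rightarrow> 'a approximable" is scaleC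
  by (rule approximable_ops_scaleC)

instance
proof
  fix T U :: "'a approximable" and r :: real and a b :: complex
  show "a *\<^sub>C (T + U) = a *\<^sub>C T + a *\<^sub>C U" by transfer (rule scaleC_add_right)
  show "(a + b) *\<^sub>C T = a *\<^sub>C T + b *\<^sub>C T" by transfer (rule scaleC_add_left)
  show "a *\<^sub>C b *\<^sub>C T = (a * b) *\<^sub>C T" by transfer (rule scaleC_scaleC)
  show "1 *\<^sub>C T = T" by transfer (rule scaleC_one)
  show "r *\<^sub>R T = complex_of_real r *\<^sub>C T" by transfer (rule scaleR_scaleC)
  show "norm (a *\<^sub>C T) = cmod a * norm T" by transfer (rule norm_scaleC)
qed

end

instance approximable :: (cbanach) cbanach
proof
  fix X :: "nat \<Rightarrow> 'a approximable"
  assume X: "Cauchy X"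
  have dist_eq: "dist T U = dist (approx_op T) (approx_op U)" for T U :: "'a approximable"
    by (simp add: dist_norm norm_approximable.rep_eq minus_approximable.rep_eq)
  have "Cauchy (\<lambda>n. approx_op (X n))"
    using X unfolding Cauchy_def dist_eq .
  then obtain L where L: "(\<lambda>n. approx_op (X n)) \<longlonglongrightarrow> L"
    using Cauchy_convergent convergent_def by blast
  have "L \<in> approximable_ops"
    unfolding approximable_ops_def
    by (rule closed_sequentially[OF closed_closure _ L]) (fold approximable_ops_def, rule approx_op)
  then have "approx_op (Abs_approximable L) = L"
    by (rule Abs_approximable_inverse)
  then have "X \<longlonglongrightarrow> Abs_approximable L"
    using L unfolding tendsto_iff dist_eq by simp
  then show "convergent X" by (auto simp: convergent_def)
qed

instantiation approximable :: (cbanach) cbanach_algebra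
begin

lift_definition times_approximable :: "'a approximable \<Rightarrow> 'a approximable \<Rightarrow> 'a approximable" is "(o\<^sub>L)"
  by (rule approximable_ops_compose)

instance
proof
  fix T U V :: "'a approximable" and r :: real and c :: complex
  show "T * U * V = T * (U * V)"
    by transfer (auto intro!: blinfun_eqI)
  show "(T + U) * V = T * V + U * V"
    by transfer (rule bounded_bilinear.add_left[OF bounded_bilinear_blinfun_compose])
  show "T * (U + V) = T * U + T * V"
    by transfer (rule bounded_bilinear.add_right[OF bounded_bilinear_blinfun_compose])
  show "r *\<^sub>R T * U = r *\<^sub>R (T * U)"
    by transfer (rule bounded_bilinear.scaleR_left[OF bounded_bilinear_blinfun_compose])
  show "T * r *\<^sub>R U = r *\<^sub>R (T * U)"
    by transfer (rule bounded_bilinear.scaleR_right[OF bounded_bilinear_blinfun_compose])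
  show "norm (T * U) \<le> norm T * norm U"
    by transfer (rule norm_blinfun_compose)
  show "c *\<^sub>C T * U = c *\<^sub>C (T * U)"
    by transfer (auto intro!: blinfun_eqI simp: scaleC_blinfun.rep_eq)
  show "T * c *\<^sub>C U = c *\<^sub>C (T * U)"
    apply transfer
    subgoal
      using approximable_ops_subset
      by (intro blinfun_eqI) (auto simp: scaleC_blinfun.rep_eq cblinfuns_def clinear_def)
    done
qed

end


section \<open>Property (A)\<close>

definition biorthogonal_system ::
    "nat \<Rightarrow> (nat \<Rightarrow> 'a::complex_normed_vector) \<Rightarrow> (nat \<Rightarrow> 'a \<Rightarrow>\<^sub>L complex) \<Rightarrow> bool"
  where "biorthogonal_system n x \<phi> \<longleftrightarrow>
    (\<forall>k<n. \<phi> k \<in> cblinfuns) \<and>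
    (\<forall>j<n. \<forall>k<n. blinfun_apply (\<phi> k) (x j) = (if j = k then 1 else 0))"

definition matrix_hom ::
    "nat \<Rightarrow> (nat \<Rightarrow> 'a::complex_normed_vector) \<Rightarrow> (nat \<Rightarrow> 'a \<Rightarrow>\<^sub>L complex) \<Rightarrow> complex mat \<Rightarrow> 'a \<Rightarrow>\<^sub>L 'a"
  where "matrix_hom n x \<phi> a = (\<Sum>j<n. \<Sum>k<n. (a $$ (j, k)) *\<^sub>C rank_one (x j) (\<phi> k))"

definition directed_set :: "'l set \<Rightarrow> ('l \<Rightarrow> 'l \<Rightarrow> bool) \<Rightarrow> bool"
  where "directed_set \<Lambda> preceq \<longleftrightarrow> \<Lambda> \<noteq> {} \<and> (\<forall>l\<in>\<Lambda>. preceq l l) \<and>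
    (\<forall>l\<in>\<Lambda>. \<forall>m\<in>\<Lambda>. \<forall>p\<in>\<Lambda>. preceq l m \<longrightarrow> preceq m p \<longrightarrow> preceq l p) \<and>
    (\<forall>l\<in>\<Lambda>. \<forall>m\<in>\<Lambda>. \<exists>p\<in>\<Lambda>. preceq l p \<and> preceq m p)"

definition net_filter :: "'l set \<Rightarrow> ('l \<Rightarrow> 'l \<Rightarrow> bool) \<Rightarrow> 'l filter"
  where "net_filter \<Lambda> preceq = (INF l\<in>\<Lambda>. principal {m \<in> \<Lambda>. preceq l m})"

lemma eventually_net_filter:
  assumes "directed_set \<Lambda> preceq"
  shows "eventually P (net_filter \<Lambda> preceq) \<longleftrightarrow> (\<exists>l\<in>\<Lambda>. \<forall>m\<in>\<Lambda>. preceq l m \<longrightarrow> P m)"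
proof -
  have ne: "\<Lambda> \<noteq> {}"
    using assms unfolding directed_set_def by (elim conjE)
  have "\<forall>l\<in>\<Lambda>. \<forall>m\<in>\<Lambda>. \<forall>p\<in>\<Lambda>. preceq l m \<longrightarrow> preceq m p \<longrightarrow> preceq l p"
    using assms unfolding directed_set_def by (elim conjE)
  then have trans: "preceq l p" if "l \<in> \<Lambda>" "m \<in> \<Lambda>" "p \<in> \<Lambda>" "preceq l m" "preceq m p" for l m p
    using that by metis
  have "\<forall>l\<in>\<Lambda>. \<forall>m\<in>\<Lambda>. \<exists>p\<in>\<Lambda>. preceq l p \<and> preceq m p"
    using assms unfolding directed_set_def by (elim conjE)
  then have ub: "\<exists>p\<in>\<Lambda>. preceq l p \<and> preceq m p" if "l \<in> \<Lambda>" "m \<in> \<Lambda>" for l m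
    using that by metis
  have base: "\<exists>p\<in>\<Lambda>. principal {q \<in> \<Lambda>. preceq p q}
      \<le> inf (principal {q \<in> \<Lambda>. preceq l q}) (principal {q \<in> \<Lambda>. preceq m q})"
    if lm: "l \<in> \<Lambda>" "m \<in> \<Lambda>" for l m
  proof -
    obtain p where p: "p \<in> \<Lambda>" "preceq l p" "preceq m p"
      using ub[OF lm] by auto
    have "{q \<in> \<Lambda>. preceq p q} \<subseteq> {q \<in> \<Lambda>. preceq l q} \<inter> {q \<in> \<Lambda>. preceq m q}"
      using trans[OF lm(1) p(1) _ p(2)] trans[OF lm(2) p(1) _ p(3)] by auto
    with p(1) show ?thesis
      by (intro bexI[of _ p]) simp_all
  qed
  show ?thesis
    unfolding net_filter_def
    by (subst eventually_INF_base[OF ne base]) (auto simp: eventually_principal)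
qed

definition GL :: "nat \<Rightarrow> complex mat monoid"
  where "GL n = units_of (ring_mat TYPE(complex) n ())"

definition spans_matrices :: "nat \<Rightarrow> complex mat set \<Rightarrow> bool"
  where "spans_matrices n G \<longleftrightarrow>
    (\<forall>M \<in> carrier_mat n n. \<exists>c. \<forall>j<n. \<forall>k<n. M $$ (j, k) = (\<Sum>t\<in>G. c t * t $$ (j, k)))"

text \<open>
  A space has property (A) iff there are data satisfying the following predicate, where the index
  type \<open>'l\<close> is arbitrary. The double supremum in the last clause being finite is expressed by
  boundedness of the (automatically finite) inner suprema.
\<close>

definition property_A_data ::
    "'l set \<Rightarrow> ('l \<Rightarrow> 'l \<Rightarrow> bool) \<Rightarrow> ('l \<Rightarrow> nat) \<Rightarrow> ('l \<Rightarrow> nat \<Rightarrow> 'a::cbanach) \<Rightarrow>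
      ('l \<Rightarrow> nat \<Rightarrow> 'a \<Rightarrow>\<^sub>L complex) \<Rightarrow> ('l \<Rightarrow> complex mat set) \<Rightarrow> bool"
  where "property_A_data \<Lambda> preceq n x \<phi> G \<longleftrightarrow>
    directed_set \<Lambda> preceq \<and>
    (\<forall>l\<in>\<Lambda>. biorthogonal_system (n l) (x l) (\<phi> l)) \<and>
    (\<forall>K :: 'a set. compact K \<longrightarrow>
      uniform_limit K (\<lambda>l y. matrix_hom (n l) (x l) (\<phi> l) (1\<^sub>m (n l)) y) (\<lambda>y. y) (net_filter \<Lambda> preceq)) \<and>
    (\<forall>K :: ('a \<Rightarrow>\<^sub>L complex) set. K \<subseteq> cblinfuns \<longrightarrow> compact K \<longrightarrow>
      uniform_limit K (\<lambda>l f. f o\<^sub>L matrix_hom (n l) (x l) (\<phi> l) (1\<^sub>m (n l))) (\<lambda>f. f) (net_filter \<Lambda> preceq)) \<and>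
    (\<forall>l\<in>\<Lambda>. finite (G l) \<and> subgroup (G l) (GL (n l)) \<and> spans_matrices (n l) (G l)) \<and>
    bdd_above ((\<lambda>l. SUP t\<in>G l. norm (matrix_hom (n l) (x l) (\<phi> l) t)) ` \<Lambda>)"


section \<open>Zero product determined Banach algebras\<close>

text \<open>\<open>Sup {}\<close> is unspecified for the reals; here it has to be \<open>0\<close>.\<close>

definition sup0 :: "real set \<Rightarrow> real"
  where "sup0 S = (if S = {} then 0 else Sup S)"

definition bounded_cbilinear :: "('a::complex_normed_vector \<Rightarrow> 'a \<Rightarrow> complex) \<Rightarrow> bool"
  where "bounded_cbilinear \<phi> \<longleftrightarrow> bounded_bilinear \<phi> \<and>
    (\<forall>c a b. \<phi> (c *\<^sub>C a) b = c * \<phi> a b \<and> \<phi> a (c *\<^sub>C b) = c * \<phi> a b)"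

definition norm_bil :: "('a::complex_normed_vector \<Rightarrow> 'a \<Rightarrow> complex) \<Rightarrow> real"
  where "norm_bil \<phi> = sup0 {cmod (\<phi> a b) | a b. norm a = 1 \<and> norm b = 1}"

definition product_functionals :: "('a::cbanach_algebra \<Rightarrow> 'a \<Rightarrow> complex) set"
  where "product_functionals = {\<lambda>a b. blinfun_apply \<xi> (a * b) | \<xi>. \<xi> \<in> cblinfuns}"

definition dist_product :: "('a::cbanach_algebra \<Rightarrow> 'a \<Rightarrow> complex) \<Rightarrow> real"
  where "dist_product \<phi> = (INF \<psi>\<in>product_functionals. norm_bil (\<lambda>a b. \<phi> a b - \<psi> a b))"

definition balance_seminorm :: "('a::cbanach_algebra \<Rightarrow> 'a \<Rightarrow> complex) \<Rightarrow> real"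
  where "balance_seminorm \<phi> =
    sup0 {cmod (\<phi> (a * b) c - \<phi> a (b * c)) | a b c. norm a = 1 \<and> norm b = 1 \<and> norm c = 1}"

definition zp_seminorm :: "('a::cbanach_algebra \<Rightarrow> 'a \<Rightarrow> complex) \<Rightarrow> real"
  where "zp_seminorm \<phi> = sup0 {cmod (\<phi> a b) | a b. norm a = 1 \<and> norm b = 1 \<and> a * b = 0}"

definition szpd_consts :: "'a::cbanach_algebra itself \<Rightarrow> real set"
  where "szpd_consts _ = {\<alpha>. \<alpha> \<ge> 0 \<and>
    (\<forall>\<phi> :: 'a \<Rightarrow> 'a \<Rightarrow> complex. bounded_cbilinear \<phi> \<longrightarrow> dist_product \<phi> \<le> \<alpha> * zp_seminorm \<phi>)}"

definition strong_B_consts :: "'a::cbanach_algebra itself \<Rightarrow> real set"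
  where "strong_B_consts _ = {\<beta>. \<beta> \<ge> 0 \<and>
    (\<forall>\<phi> :: 'a \<Rightarrow> 'a \<Rightarrow> complex. bounded_cbilinear \<phi> \<longrightarrow> balance_seminorm \<phi> \<le> \<beta> * zp_seminorm \<phi>)}"

definition strongly_zero_product_determined :: "'a::cbanach_algebra itself \<Rightarrow> bool"
  where "strongly_zero_product_determined A \<longleftrightarrow> szpd_consts A \<noteq> {}"

definition strong_property_B :: "'a::cbanach_algebra itself \<Rightarrow> bool"
  where "strong_property_B A \<longleftrightarrow> strong_B_consts A \<noteq> {}"

text \<open>The optimal constants; they are meaningful only if the algebra has the respective property.\<close>

definition alpha_const :: "'a::cbanach_algebra itself \<Rightarrow> real"
  where "alpha_const A = Inf (szpd_consts A)"

definition beta_const :: "'a::cbanach_algebra itself \<Rightarrow> real"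
  where "beta_const A = Inf (strong_B_consts A)"

text \<open>The infima are attained, so they are indeed the smallest constants.\<close>

lemma Inf_const_mem:
  fixes d z :: "'p \<Rightarrow> real"
  assumes S: "S = {a. a \<ge> 0 \<and> (\<forall>p. Q p \<longrightarrow> d p \<le> a * z p)}" "S \<noteq> {}"
    and z: "\<And>p. Q p \<Longrightarrow> z p \<ge> 0"
  shows "Inf S \<in> S"
proof -
  have "closed S"
  proof -
    have "S = {0..} \<inter> (\<Inter>p\<in>{p. Q p}. {a. d p \<le> a * z p})" using S by auto
    moreover have "closed {a. d p \<le> a * z p}" for p
      by (intro closed_Collect_le continuous_intros)
    ultimately show ?thesis by auto
  qed
  moreover have "bdd_below S" using S by (intro bdd_belowI[of _ 0]) auto
  ultimately show ?thesis using S(2) by (intro closed_contains_Inf)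
qed

lemma zp_seminorm_nonneg:
  fixes \<phi> :: "'a::cbanach_algebra \<Rightarrow> 'a \<Rightarrow> complex"
  assumes "bounded_cbilinear \<phi>"
  shows "zp_seminorm \<phi> \<ge> 0"
proof -
  let ?S = "{cmod (\<phi> a b) | a b. norm a = 1 \<and> norm b = 1 \<and> a * b = 0}"
  obtain K where K: "\<And>a b. cmod (\<phi> a b) \<le> norm a * norm b * K"
    using assms bounded_bilinear.bounded unfolding bounded_cbilinear_def by blast
  have bdd: "bdd_above ?S"
  proof (rule bdd_aboveI[of _ K])
    fix s assume "s \<in> ?S"
    then obtain a b where "s = cmod (\<phi> a b)" "norm a = 1" "norm b = 1" by auto
    with K[of a b] show "s \<le> K" by simp
  qed
  show ?thesis
  proof (cases "?S = {}")
    case True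
    then show ?thesis unfolding zp_seminorm_def sup0_def by simp
  next
    case False
    then obtain s where s: "s \<in> ?S" by blast
    then have "0 \<le> s" by auto
    also have "s \<le> Sup ?S" using s bdd by (rule cSup_upper)
    finally show ?thesis using False unfolding zp_seminorm_def sup0_def by simp
  qed
qed

lemma alpha_const_mem: "strongly_zero_product_determined A \<Longrightarrow> alpha_const A \<in> szpd_consts A"
  unfolding strongly_zero_product_determined_def alpha_const_def szpd_consts_def
  by (rule Inf_const_mem[OF refl]) (auto intro: zp_seminorm_nonneg)

lemma beta_const_mem: "strong_property_B A \<Longrightarrow> beta_const A \<in> strong_B_consts A"
  unfolding strong_property_B_def beta_const_def strong_B_consts_def
  by (rule Inf_const_mem[OF refl]) (auto intro: zp_seminorm_nonneg)

end

theory Submission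
  imports Defs "HOL-Algebra.Multiplicative_Group"
begin

text \<open>
  The heart of the matter is that rotating a pair \<open>(a, b)\<close> to \<open>(a t, t\<^sup>-\<^sup>1 b)\<close> by a power-bounded
  element \<open>t\<close> of finite order changes \<open>\<phi>\<close> by at most a fixed multiple of \<open>|\<phi>|\<close> on zero products.
  Two tent functions on the circle with disjoint supports around \<open>1\<close> and \<open>-1\<close>, evaluated at
  \<open>t\<close>, give zero products. Averaging over all rotations of the pair of tents yields that
  \<open>\<Sum>(-1)\<^sup>k c\<^sub>k\<^sup>2 \<phi>(a t\<^sup>k, t\<^sup>-\<^sup>k b)\<close> is small, with \<open>c\<^sub>k\<close> the Fourier coefficients of the tent. The
  coefficient \<open>c\<^sub>1\<close> is large enough compared with the even ones that this inequality, applied to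
  the pair of powers where \<open>k \<mapsto> \<phi>(a t\<^sup>k, t\<^sup>-\<^sup>k b)\<close> varies most, bounds that oscillation.

  Since \<open>G\<^sub>\<lambda>\<close> spans the matrices, the average of \<open>t \<otimes> t\<^sup>-\<^sup>1\<close> over \<open>G\<^sub>\<lambda>\<close> is a diagonal, so the
  functionals \<open>c \<mapsto> avg \<phi>(c t, t\<^sup>-\<^sup>1)\<close> come close to representing \<open>\<phi>\<close> through the product, and a
  weak-star cluster point of them does so on the whole algebra. This gives the constant \<open>300 C\<^sup>2\<close>,
  which is smaller than the one claimed.
\<close>

section \<open>Characters and tent functions on finite cyclic groups\<close>

lemma sum_periodic_shift:
  fixes f :: "int \<Rightarrow> 'b::comm_monoid_add"
  assumes "m > 0" and per: "\<And>k. f (k mod m) = f k"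
  shows "(\<Sum>k\<in>{0..<m}. f (k + s)) = (\<Sum>k\<in>{0..<m}. f k)"
proof (rule sum.reindex_bij_witness[where i = "\<lambda>k. (k - s) mod m" and j = "\<lambda>k. (k + s) mod m"])
  show "f ((k + s) mod m) = f (k + s)" for k by (rule per)
qed (use \<open>m > 0\<close> in \<open>auto simp: mod_add_left_eq mod_diff_left_eq\<close>)

definition root_char :: "int \<Rightarrow> int \<Rightarrow> complex"
  where "root_char m k = cis (2 * pi * k / m)"

lemma root_char_add: "root_char m (j + k) = root_char m j * root_char m k"
  unfolding root_char_def cis_mult of_int_add distrib_left add_divide_distrib ..

lemma root_char_0 [simp]: "root_char m 0 = 1"
  by (simp add: root_char_def)

lemma cmod_root_char [simp]: "cmod (root_char m k) = 1"
  by (simp add: root_char_def)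

lemma cnj_root_char: "cnj (root_char m k) = root_char m (- k)"
  by (simp add: root_char_def cis_cnj)

lemma root_char_eq_1_iff:
  assumes "m > 0"
  shows "root_char m k = 1 \<longleftrightarrow> m dvd k"
proof -
  have "root_char m k = 1 \<longleftrightarrow> (\<exists>i::int. 2 * pi * k / m = of_int (2 * i) * pi)"
    unfolding root_char_def cis_conv_exp exp_eq_1 by simp
  also have "\<dots> \<longleftrightarrow> (\<exists>i::int. real_of_int k = real_of_int (m * i))"
  proof (rule ex_cong1)
    fix i :: int
    have "2 * pi * k / m = of_int (2 * i) * pi \<longleftrightarrow> (2 * pi) * real_of_int k = (2 * pi) * real_of_int (m * i)"
      using assms by (simp add: divide_eq_eq mult_ac)
    then show "2 * pi * k / m = of_int (2 * i) * pi \<longleftrightarrow> real_of_int k = real_of_int (m * i)"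
      by simp
  qed
  also have "\<dots> \<longleftrightarrow> m dvd k"
    unfolding of_int_eq_iff dvd_def ..
  finally show ?thesis .
qed

lemma root_char_mod: "m > 0 \<Longrightarrow> root_char m (k mod m) = root_char m k"
  using root_char_add[of m "k mod m" "m * (k div m)"] by (simp add: root_char_eq_1_iff)

text \<open>Orthogonality of characters: if \<open>m\<close> does not divide \<open>j\<close>,
  shifting the index by 1 multiplies the sum by a root of unity other than 1, so the sum
  vanishes.\<close>

lemma sum_root_char:
  assumes "m > 0"
  shows "(\<Sum>k\<in>{0..<m}. root_char m (j * k)) = (if m dvd j then of_int m else 0)"
proof (cases "m dvd j")
  case True
  then have "root_char m (j * k) = 1" for k
    using assms by (simp add: root_char_eq_1_iff)
  then show ?thesis using True assms by simp
next
  case False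
  let ?S = "\<Sum>k\<in>{0..<m}. root_char m (j * k)"
  have "?S = (\<Sum>k\<in>{0..<m}. root_char m (j * (k + 1)))"
    by (rule sum_periodic_shift[symmetric])
      (use assms in \<open>auto, metis root_char_mod mod_mult_right_eq\<close>)
  also have "\<dots> = root_char m j * ?S"
    by (simp add: ring_distribs root_char_add sum_distrib_left mult.commute)
  finally have "(1 - root_char m j) * ?S = 0" by (simp add: algebra_simps)
  then show ?thesis using False assms by (simp add: root_char_eq_1_iff)
qed

text \<open>Multiplying the \<open>k\<close>-th Fourier coefficient by this sign moves a function on
  the circle of \<open>4 * L\<close> points by half a turn, hence the tent at 1 to the tent at
  -1.\<close>

lemma root_char_half:
  assumes "L > 0"
  shows "root_char (4 * L) (2 * L * k) = (if even k then 1 else - 1)"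
proof -
  have "root_char (4 * L) (2 * L * k) = cis (pi * k)"
    using assms by (simp add: root_char_def)
  then show ?thesis
    by (simp add: complex_eq_iff cos_int_times_real sin_int_times_real mult.commute)
qed

text \<open>The discrete Fourier coefficients of the tent of height \<open>1\<close> supported on a half circle.\<close>

definition tent_coeff :: "int \<Rightarrow> int \<Rightarrow> real"
  where "tent_coeff L k = (cmod (\<Sum>j\<in>{0..<L}. root_char (4 * L) (j * k)))\<^sup>2 / (4 * L\<^sup>2)"

lemma tent_coeff_nonneg: "tent_coeff L k \<ge> 0"
  by (simp add: tent_coeff_def)

text \<open>The double sum shows the tent as the autocorrelation of an interval of length
  \<open>L\<close>: its value at \<open>j\<close> is the number of pairs with
  \<open>a - b = j\<close> modulo \<open>4 * L\<close>, divided by \<open>L\<close>. The later sums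
  over \<open>k\<close> are evaluated in this form by orthogonality.\<close>

lemma tent_coeff_eq:
  "complex_of_real (tent_coeff L k) =
    inverse (4 * of_int L ^ 2) * (\<Sum>a\<in>{0..<L}. \<Sum>b\<in>{0..<L}. root_char (4 * L) ((a - b) * k))"
proof -
  have "root_char (4 * L) (a * k) * root_char (4 * L) (- (b * k)) = root_char (4 * L) ((a - b) * k)" for a b
    unfolding root_char_add[symmetric] by (simp add: left_diff_distrib)
  then have sq: "complex_of_real ((cmod (\<Sum>j\<in>{0..<L}. root_char (4 * L) (j * k)))\<^sup>2) =
    (\<Sum>a\<in>{0..<L}. \<Sum>b\<in>{0..<L}. root_char (4 * L) ((a - b) * k))"
    by (simp only: complex_norm_square cnj_sum cnj_root_char sum_product)
  have "complex_of_real (real_of_int (4 * L\<^sup>2)) = 4 * of_int L ^ 2" by simp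
  then show ?thesis
    unfolding tent_coeff_def of_real_divide sq by (simp only: divide_inverse mult.commute)
qed

lemma tent_coeff_mod:
  assumes "L > 0"
  shows "tent_coeff L (k mod (4 * L)) = tent_coeff L k"
proof -
  have "root_char (4 * L) (j * (k mod (4 * L))) = root_char (4 * L) (j * k)" for j
    using root_char_mod[of "4 * L" "j * (k mod (4 * L))"] root_char_mod[of "4 * L" "j * k"] assms
    by (simp add: mod_mult_right_eq)
  then show ?thesis by (simp only: tent_coeff_def)
qed

lemma tent_coeff_minus: "tent_coeff L (- k) = tent_coeff L k"
proof -
  have "complex_of_real (tent_coeff L (- k)) = complex_of_real (tent_coeff L k)"
    unfolding tent_coeff_eq
    by (subst sum.swap) (simp add: left_diff_distrib)
  then show ?thesis by (simp only: of_real_eq_iff)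
qed

lemma tent_coeff_0:
  assumes "L > 0" shows "tent_coeff L 0 = 1 / 4"
  using assms by (simp add: tent_coeff_def)

text \<open>Fourier inversion at the centre of the tent, where its height is 1: only the
  \<open>L\<close> diagonal pairs \<open>a = b\<close> survive. The coefficients are thus convex
  weights.\<close>

lemma sum_tent_coeff:
  assumes L: "L > 0"
  shows "(\<Sum>k\<in>{0..<4*L}. tent_coeff L k) = 1"
proof -
  have "complex_of_real (\<Sum>k\<in>{0..<4*L}. tent_coeff L k) =
    inverse (4 * of_int L ^ 2) * (\<Sum>k\<in>{0..<4*L}. \<Sum>a\<in>{0..<L}. \<Sum>b\<in>{0..<L}. root_char (4 * L) ((a - b) * k))"
    by (simp only: of_real_sum tent_coeff_eq sum_distrib_left)
  also have "(\<Sum>k\<in>{0..<4*L}. \<Sum>a\<in>{0..<L}. \<Sum>b\<in>{0..<L}. root_char (4 * L) ((a - b) * k)) =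
    (\<Sum>a\<in>{0..<L}. \<Sum>b\<in>{0..<L}. \<Sum>k\<in>{0..<4*L}. root_char (4 * L) ((a - b) * k))"
    by (subst sum.swap, rule sum.cong[OF refl], rule sum.swap)
  also have "\<dots> = (\<Sum>a\<in>{0..<L}. \<Sum>b\<in>{0..<L}. if a = b then of_int (4 * L) else 0)"
  proof (intro sum.cong refl)
    fix a b assume "a \<in> {0..<L}" "b \<in> {0..<L}"
    then have "4 * L dvd a - b \<longleftrightarrow> a = b"
      using zdvd_imp_le[of "4 * L" "a - b"] zdvd_imp_le[of "4 * L" "b - a"]
      by (auto simp: dvd_diff_commute) (metis linorder_neqE_linordered_idom)
    then show "(\<Sum>k\<in>{0..<4*L}. root_char (4 * L) ((a - b) * k)) = (if a = b then of_int (4 * L) else 0)"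
      using L by (subst sum_root_char) auto
  qed
  also have "\<dots> = of_int L * of_int (4 * L)"
    using L by (simp add: sum.delta)
  also have "inverse (4 * of_int L ^ 2) * \<dots> = 1"
    using L by (simp add: power2_eq_square field_simps)
  finally show ?thesis by (metis of_real_eq_1_iff)
qed

text \<open>The tents centred at \<open>1\<close> and at \<open>-1\<close> have disjoint supports.\<close>

lemma tent_coeff_convolution:
  assumes L: "L > 0"
  shows "(\<Sum>k\<in>{0..<4*L}. tent_coeff L k * (tent_coeff L (s - k) * (if even (s - k) then 1 else - 1))) = 0"
proof -
  let ?w = "root_char (4 * L)" and ?I = "{0..<L}"
  have L4: "4 * L > 0" using L by simp
  have sgn: "complex_of_real (if even k then 1 else - 1) = ?w (2 * L * k)" for k
    using L by (simp add: root_char_half)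
  let ?c = "inverse (4 * of_int L ^ 2) :: complex"
  have "complex_of_real (\<Sum>k\<in>{0..<4*L}. tent_coeff L k * (tent_coeff L (s - k) * (if even (s - k) then 1 else - 1)))
    = ?c\<^sup>2 * (\<Sum>k\<in>{0..<4*L}. (\<Sum>a\<in>?I. \<Sum>b\<in>?I. ?w ((a - b) * k)) *
        ((\<Sum>c\<in>?I. \<Sum>d\<in>?I. ?w ((c - d) * (s - k))) * ?w (2 * L * (s - k))))"
    unfolding of_real_sum of_real_mult sgn tent_coeff_eq
    by (subst sum_distrib_left, rule sum.cong[OF refl])
      (simp only: power2_eq_square mult.assoc mult.left_commute)
  also have "(\<Sum>k\<in>{0..<4*L}. (\<Sum>a\<in>?I. \<Sum>b\<in>?I. ?w ((a - b) * k)) *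
        ((\<Sum>c\<in>?I. \<Sum>d\<in>?I. ?w ((c - d) * (s - k))) * ?w (2 * L * (s - k))))
    = (\<Sum>k\<in>{0..<4*L}. \<Sum>a\<in>?I. \<Sum>b\<in>?I. \<Sum>c\<in>?I. \<Sum>d\<in>?I. 
        ?w ((c - d + 2 * L) * s) * ?w ((a - b - (c - d) - 2 * L) * k))"
    unfolding sum_distrib_right
    by (simp only: sum_distrib_left flip: root_char_add) (simp add: algebra_simps)
  also have "\<dots> = (\<Sum>a\<in>?I. \<Sum>b\<in>?I. \<Sum>c\<in>?I. \<Sum>d\<in>?I. \<Sum>k\<in>{0..<4*L}.
        ?w ((c - d + 2 * L) * s) * ?w ((a - b - (c - d) - 2 * L) * k))"
    by (subst sum.swap, rule sum.cong[OF refl])+ (rule refl)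
  also have "\<dots> = 0"
  proof (rule sum.neutral, rule ballI, rule sum.neutral, rule ballI, rule sum.neutral, rule ballI, rule sum.neutral, rule ballI)
    fix a b c d assume abcd: "a \<in> ?I" "b \<in> ?I" "c \<in> ?I" "d \<in> ?I"
    \<comment> \<open>Both differences have absolute value at most \<open>L - 1\<close>, so the
      negated number lies between 2 and \<open>4 * L - 2\<close>. This is the disjointness of the
      supports.\<close>
    have "\<not> 4 * L dvd - (a - b - (c - d) - 2 * L)"
      by (rule zdvd_not_zless) (use abcd in auto)
    then have n: "\<not> 4 * L dvd a - b - (c - d) - 2 * L"
      by (simp only: dvd_minus_iff not_False_eq_True)
    show "(\<Sum>k\<in>{0..<4*L}. ?w ((c - d + 2 * L) * s) * ?w ((a - b - (c - d) - 2 * L) * k)) = 0"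
      unfolding sum_distrib_left[symmetric] sum_root_char[OF L4] if_not_P[OF n] by simp
  qed
  finally show ?thesis by (simp only: mult_zero_right of_real_eq_0_iff)
qed

section \<open>Estimates separating the first tent coefficient from the even ones\<close>

lemma sum_tent_coeff_alternating:
  assumes L: "L > 0"
  shows "(\<Sum>k\<in>{0..<4*L}. (if even k then 1 else - 1) * tent_coeff L k) = 0"
proof -
  let ?w = "root_char (4 * L)" and ?I = "{0..<L}"
  have L4: "4 * L > 0" using L by simp
  have sgn: "complex_of_real (if even k then 1 else - 1) = ?w (2 * L * k)" for k
    using L by (simp add: root_char_half)
  have expand: "complex_of_real (\<Sum>k\<in>{0..<4*L}. (if even k then 1 else - 1) * tent_coeff L k)
    = inverse (4 * of_int L ^ 2) * (\<Sum>k\<in>{0..<4*L}. ?w (2 * L * k) * (\<Sum>a\<in>?I. \<Sum>b\<in>?I. ?w ((a - b) * k)))"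
    unfolding of_real_sum of_real_mult sgn tent_coeff_eq
    by (subst sum_distrib_left, rule sum.cong[OF refl], rule mult.left_commute)
  have "(\<Sum>k\<in>{0..<4*L}. ?w (2 * L * k) * (\<Sum>a\<in>?I. \<Sum>b\<in>?I. ?w ((a - b) * k)))
    = (\<Sum>k\<in>{0..<4*L}. \<Sum>a\<in>?I. \<Sum>b\<in>?I. ?w ((a - b + 2 * L) * k))"
    by (simp only: sum_distrib_left flip: root_char_add) (simp add: algebra_simps)
  also have "\<dots> = (\<Sum>a\<in>?I. \<Sum>b\<in>?I. \<Sum>k\<in>{0..<4*L}. ?w ((a - b + 2 * L) * k))"
    by (subst sum.swap, rule sum.cong[OF refl]) (rule sum.swap)
  also have "\<dots> = 0"
  proof (rule sum.neutral, rule ballI, rule sum.neutral, rule ballI)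
    fix a b assume ab: "a \<in> ?I" "b \<in> ?I"
    \<comment> \<open>The number lies between \<open>L + 1\<close> and \<open>3 * L - 1\<close>. The
      alternating sum is the value of the tent at the antipode of its centre, which is outside its
      support.\<close>
    have n: "\<not> 4 * L dvd a - b + 2 * L"
      by (rule zdvd_not_zless) (use ab in auto)
    show "(\<Sum>k\<in>{0..<4*L}. ?w ((a - b + 2 * L) * k)) = 0"
      unfolding sum_root_char[OF L4] if_not_P[OF n] by simp
  qed
  finally show ?thesis
    using expand by (simp only: mult_zero_right of_real_eq_0_iff)
qed

lemma sum_tent_coeff_even:
  assumes L: "L > 0"
  shows "(\<Sum>k\<in>{k\<in>{0..<4*L}. even k}. tent_coeff L k) = 1 / 2"
proof -
  have "(\<Sum>k\<in>{k\<in>{0..<4*L}. even k}. tent_coeff L k) = (\<Sum>k\<in>{0..<4*L}. if even k then tent_coeff L k else 0)"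
    by (rule sum.inter_filter) simp
  also have "\<dots> = (\<Sum>k\<in>{0..<4*L}. (tent_coeff L k + (if even k then 1 else - 1) * tent_coeff L k) / 2)"
    by (rule sum.cong) auto
  also have "\<dots> = 1 / 2"
    by (simp only: sum_divide_distrib[symmetric] sum.distrib sum_tent_coeff[OF L]
        sum_tent_coeff_alternating[OF L]) simp
  finally show ?thesis .
qed

text \<open>At this frequency the characters alternate between 1 and -1, and an even number of them
  cancel in pairs.\<close>

lemma tent_coeff_half:
  assumes "L > 0" "even L" shows "tent_coeff L (2 * L) = 0"
proof -
  have "(\<Sum>j\<in>{0..<2*i}. root_char (4 * L) (j * (2 * L))) = 0" if "i \<ge> 0" for i :: int
    using that
  proof (induction i rule: int_ge_induct)
    case (step i)
    have "{0..<2 * (i + 1)} = insert (2 * i) (insert (2 * i + 1) {0..<2 * i})"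
      using step.hyps by auto
    then show ?case
      using step.IH root_char_half[OF \<open>L > 0\<close>, of "2 * i"] root_char_half[OF \<open>L > 0\<close>, of "2 * i + 1"]
      by (simp add: mult.commute)
  qed simp
  from this[of "L div 2"] show ?thesis
    using assms by (simp add: tent_coeff_def)
qed

text \<open>The frequencies \<open>k\<close> and \<open>4 * L - k\<close> have equal coefficients.
  If they differ, these two and the value \<open>1 / 4\<close> at 0 are part of an even sum of
  \<open>1 / 2\<close>, so twice the coefficient is at most \<open>1 / 4\<close>. The self-paired
  frequency \<open>2 * L\<close> is the case treated separately.\<close>

lemma tent_coeff_even_le:
  assumes "L > 0" "even L" "even k" "0 < k" "k < 4 * L"
  shows "tent_coeff L k \<le> 1 / 8"
proof (cases "k = 2 * L")
  case True
  then show ?thesis using tent_coeff_half assms by simp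
next
  case False
  have "tent_coeff L (4 * L - k) = tent_coeff L ((- k) mod (4 * L))"
    using assms by (simp add: zmod_zminus1_eq_if)
  also have "\<dots> = tent_coeff L k"
    using assms by (simp only: tent_coeff_mod tent_coeff_minus)
  finally have sym: "tent_coeff L (4 * L - k) = tent_coeff L k" .
  have "(\<Sum>i\<in>{0, k, 4 * L - k}. tent_coeff L i) \<le> (\<Sum>k\<in>{k\<in>{0..<4*L}. even k}. tent_coeff L k)"
  proof (rule sum_mono2)
    show "finite {k \<in> {0..<4*L}. even k}" by (rule finite_Collect_conjI) simp
  qed (use assms in \<open>auto simp: tent_coeff_nonneg\<close>)
  then show ?thesis
    unfolding sum_tent_coeff_even[OF assms(1)] using assms False by (simp add: sym tent_coeff_0)
qed

text \<open>Each square is at most \<open>1 / 8\<close> times the coefficient, and without the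
  frequency 0 the even coefficients sum to \<open>1 / 2 - 1 / 4\<close>.\<close>

lemma sum_tent_coeff_even_squares:
  assumes "L > 0" "even L"
  shows "(\<Sum>k\<in>{k\<in>{0<..<4*L}. even k}. (tent_coeff L k)\<^sup>2) \<le> 1 / 32"
proof -
  have split: "{k\<in>{0..<4*L}. even k} = insert 0 {k\<in>{0<..<4*L}. even k}"
    using assms by auto
  have "finite {k\<in>{0<..<4*L}. even k}" by (rule finite_Collect_conjI) simp
  with sum_tent_coeff_even[OF assms(1)] have s: "(\<Sum>k\<in>{k\<in>{0<..<4*L}. even k}. tent_coeff L k) = 1 / 4"
    unfolding split by (subst (asm) sum.insert) (auto simp: tent_coeff_0 assms)
  have "(\<Sum>k\<in>{k\<in>{0<..<4*L}. even k}. (tent_coeff L k)\<^sup>2) \<le> (\<Sum>k\<in>{k\<in>{0<..<4*L}. even k}. 1 / 8 * tent_coeff L k)"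
    unfolding power2_eq_square
    by (rule sum_mono, rule mult_right_mono) (use assms tent_coeff_even_le tent_coeff_nonneg in auto)
  also have "\<dots> = 1 / 32"
    unfolding sum_distrib_left[symmetric] s by simp
  finally show ?thesis .
qed

text \<open>The geometric sum of the first \<open>L\<close> powers spans a quarter turn, so its
  modulus is \<open>sqrt 2\<close> divided by the chord from 1 to the next root of unity. The arc
  length \<open>pi / (2 * L)\<close> bounds that chord.\<close>

lemma tent_coeff_1_ge:
  assumes L: "L > 0"
  shows "tent_coeff L 1 \<ge> 2 / pi\<^sup>2"
proof -
  let ?w = "root_char (4 * L)"
  let ?S = "\<Sum>j\<in>{0..<L}. ?w j"
  have tel: "(\<Sum>j\<in>{0..<i}. ?w j) * (1 - ?w 1) = 1 - ?w i" if "i \<ge> 0" for i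
    using that
  proof (induction i rule: int_ge_induct)
    case (step i)
    have "{0..<i + 1} = insert i {0..<i}" using step.hyps by auto
    then have "(\<Sum>j\<in>{0..<i + 1}. ?w j) * (1 - ?w 1) = ?w i * (1 - ?w 1) + (\<Sum>j\<in>{0..<i}. ?w j) * (1 - ?w 1)"
      by (simp add: ring_distribs)
    then show ?case unfolding step.IH by (simp add: root_char_add ring_distribs)
  qed simp
  have "?w L = \<i>"
    using L by (simp add: root_char_def flip: cis_pi_half)
  with tel[of L] L have "cmod ?S * cmod (1 - ?w 1) = cmod (1 - \<i>)"
    by (metis norm_mult less_imp_le)
  also have "\<dots> = sqrt 2" by (simp add: cmod_def)
  finally have 1: "cmod ?S * cmod (1 - ?w 1) = sqrt 2" .
  have "cmod (1 - ?w 1) = 2 * \<bar>sin (2 * pi / (4 * L) / 2)\<bar>"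
    using dist_exp_i_1[of "2 * pi / (4 * L)"]
    by (simp add: root_char_def cis_conv_exp norm_minus_commute mult_ac)
  also have "\<dots> \<le> 2 * \<bar>2 * pi / (4 * L) / 2\<bar>"
    by (intro mult_left_mono abs_sin_x_le_abs_x) auto
  also have "\<dots> = pi / (2 * L)" using L by simp
  finally have "sqrt 2 \<le> cmod ?S * (pi / (2 * L))"
    unfolding 1[symmetric] by (rule mult_left_mono) simp
  then have "sqrt 2 ^ 2 \<le> (cmod ?S * (pi / (2 * L)))\<^sup>2"
    by (rule power_mono) simp
  then have "2 \<le> (cmod ?S)\<^sup>2 * (pi\<^sup>2 / (4 * L\<^sup>2))"
    by (simp add: power_mult_distrib power_divide)
  then show ?thesis
    using L by (simp add: tent_coeff_def field_simps)
qed

text \<open>The gap between the weight of frequency 1 and the total weight of the nonzero even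
  frequencies; its reciprocal bound 300 becomes the final constant.\<close>

lemma tent_coeff_1_square_ge:
  assumes L: "L > 0"
  shows "(tent_coeff L 1)\<^sup>2 - 1 / 32 \<ge> 1 / 300"
proof -
  have "pi \<le> 32 / 10"
    \<comment> \<open>Machin's formula \<open>pi / 4 = 4 * arctan (1 / 5) - arctan (1 / 239)\<close>
      gives \<open>pi / 4 < 4 / 5\<close>.\<close>
    using pi_machin arctan_le_self[of "1 / 5"] zero_less_arctan_iff[of "1 / 239"] by linarith
  then have "pi\<^sup>2 \<le> (32 / 10)\<^sup>2" by (intro power_mono) auto
  then have "2 / pi\<^sup>2 \<ge> 2 / (32 / 10)\<^sup>2" by (intro divide_left_mono) auto
  then have "tent_coeff L 1 \<ge> 2 / (32 / 10)\<^sup>2"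
    using tent_coeff_1_ge[OF L] by linarith
  then have "(tent_coeff L 1)\<^sup>2 \<ge> (2 / (32 / 10)\<^sup>2)\<^sup>2" by (intro power_mono) auto
  then show ?thesis by (simp add: power2_eq_square)
qed

section \<open>Rotating a pair by a power-bounded element of finite order\<close>

lemma bounded_cbilinear_sum:
  assumes "bounded_cbilinear \<phi>"
  shows "\<phi> (\<Sum>k\<in>I. c k *\<^sub>C f k) (\<Sum>l\<in>J. d l *\<^sub>C g l) = (\<Sum>k\<in>I. \<Sum>l\<in>J. c k * d l * \<phi> (f k) (g l))"
proof -
  interpret bounded_bilinear \<phi> using assms by (simp add: bounded_cbilinear_def)
  have sc: "\<phi> (z *\<^sub>C a) b = z * \<phi> a b" "\<phi> a (z *\<^sub>C b) = z * \<phi> a b" for z a b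
    using assms by (simp_all add: bounded_cbilinear_def)
  show ?thesis
    unfolding sum_left unfolding sum_right by (simp add: sc mult_ac)
qed

lemma mult_sum_scaleC:
  fixes f g :: "'i \<Rightarrow> 'a::complex_normed_algebra"
  shows "(\<Sum>k\<in>I. c k *\<^sub>C f k) * (\<Sum>l\<in>J. d l *\<^sub>C g l) = (\<Sum>k\<in>I. \<Sum>l\<in>J. (c k * d l) *\<^sub>C (f k * g l))"
  by (simp add: sum_product mult_scaleC_left mult_scaleC_right scaleC_scaleC mult.commute)

text \<open>Homogeneous form of the seminorm: normalising both factors keeps their product zero, and
  boundedness of \<open>\<phi>\<close> makes the supremum finite.\<close>

lemma cmod_le_zp_seminorm:
  fixes a b :: "'a::cbanach_algebra"
  assumes \<phi>: "bounded_cbilinear \<phi>" and ab: "a * b = 0"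
  shows "cmod (\<phi> a b) \<le> zp_seminorm \<phi> * (norm a * norm b)"
proof (cases "a = 0 \<or> b = 0")
  case True
  then show ?thesis
    using \<phi> bounded_bilinear.zero_left bounded_bilinear.zero_right
    unfolding bounded_cbilinear_def by fastforce
next
  case False
  let ?S = "{cmod (\<phi> a b) | a b. norm a = 1 \<and> norm b = 1 \<and> a * b = 0}"
  interpret bounded_bilinear \<phi> using \<phi> by (simp add: bounded_cbilinear_def)
  obtain K where K: "\<And>a b. cmod (\<phi> a b) \<le> norm a * norm b * K"
    using bounded by blast
  have bdd: "bdd_above ?S"
  proof (rule bdd_aboveI[of _ K])
    fix s assume "s \<in> ?S"
    then obtain a b where "s = cmod (\<phi> a b)" "norm a = 1" "norm b = 1" by auto
    with K[of a b] show "s \<le> K" by simp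
  qed
  define a' where "a' = (1 / norm a) *\<^sub>R a"
  define b' where "b' = (1 / norm b) *\<^sub>R b"
  have "a' * b' = 0" using ab by (simp add: a'_def b'_def)
  moreover have "norm a' = 1" "norm b' = 1" using False by (simp_all add: a'_def b'_def)
  ultimately have mem: "cmod (\<phi> a' b') \<in> ?S" by blast
  then have "cmod (\<phi> a' b') \<le> Sup ?S" using bdd by (rule cSup_upper)
  also have "\<dots> = zp_seminorm \<phi>" using mem unfolding zp_seminorm_def sup0_def by (metis empty_iff)
  finally have "cmod (\<phi> a' b') * (norm a * norm b) \<le> zp_seminorm \<phi> * (norm a * norm b)"
    by (intro mult_right_mono) auto
  then show ?thesis
    using False by (simp add: a'_def b'_def scaleR_left scaleR_right norm_mult field_simps)
qed

text \<open>\<open>A k\<close> and \<open>B k\<close> abstract \<open>a t^k\<close> and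
  \<open>t^k b\<close>; the algebra need not contain the powers themselves. The elements
  \<open>F r\<close> and \<open>G r\<close> are the two opposite tents, rotated by \<open>r\<close>
  and evaluated at \<open>t\<close>, multiplied by \<open>a\<close> and \<open>b\<close>. Their
  product vanishes, and averaging over \<open>r\<close> leaves the diagonal terms.\<close>

lemma alternating_tent_squares_bound:
  fixes \<phi> :: "'a::cbanach_algebra \<Rightarrow> 'a \<Rightarrow> complex" and A B :: "int \<Rightarrow> 'a"
  assumes \<phi>: "bounded_cbilinear \<phi>" and L: "L > 0"
    and perA: "\<And>k. A (k mod (4 * L)) = A k" and perB: "\<And>k. B (k mod (4 * L)) = B k"
    and AB: "\<And>k l. A k * B l = A (k + l) * B 0"
    and nA: "\<And>k. norm (A k) \<le> \<alpha>" and nB: "\<And>k. norm (B k) \<le> \<beta>"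
  shows "cmod (\<Sum>k\<in>{0..<4*L}. complex_of_real ((if even k then 1 else - 1) * (tent_coeff L k)\<^sup>2) * \<phi> (A k) (B (- k)))
    \<le> zp_seminorm \<phi> * (\<alpha> * \<beta>)"
proof -
  define m where "m = 4 * L"
  define I where "I = {0..<m}"
  have m: "m > 0" "even m" using L by (auto simp: m_def)
  define w where "w = root_char m"
  define t where "t k = complex_of_real (tent_coeff L k)" for k
  define e :: "int \<Rightarrow> complex" where "e k = (if even k then 1 else - 1)" for k
  have per: "A (k mod m) = A k" "B (k mod m) = B k" "w (k mod m) = w k" "t (k mod m) = t k" for k
    using perA perB m(1) tent_coeff_mod[OF L] by (simp_all add: m_def w_def t_def root_char_mod)
  have e_mod: "e (k mod m) = e k" for k
    using m(2) by (simp add: e_def dvd_mod_iff)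
  have norm_w: "cmod (w k) = 1" for k by (simp add: w_def)
  have norm_e: "cmod (e k) = 1" for k by (simp add: e_def)
  have sum_norm_t: "(\<Sum>k\<in>I. cmod (t k)) = 1"
    using sum_tent_coeff[OF L] by (simp add: t_def tent_coeff_nonneg I_def m_def)
  define F where "F r = (\<Sum>k\<in>I. (t k * w (r * k)) *\<^sub>C A k)" for r
  define G where "G r = (\<Sum>l\<in>I. (e l * t l * w (r * l)) *\<^sub>C B l)" for r
  have nF: "norm (F r) \<le> \<alpha>" for r
  proof -
    have "norm (F r) \<le> (\<Sum>k\<in>I. cmod (t k) * \<alpha>)"
      unfolding F_def
      by (rule sum_norm_le) (simp add: norm_scaleC norm_mult norm_w mult_left_mono nA)
    then show ?thesis by (simp add: sum_norm_t flip: sum_distrib_right)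
  qed
  have nG: "norm (G r) \<le> \<beta>" for r
  proof -
    have "norm (G r) \<le> (\<Sum>k\<in>I. cmod (t k) * \<beta>)"
      unfolding G_def
      by (rule sum_norm_le) (simp add: norm_scaleC norm_mult norm_w norm_e mult_left_mono nB)
    then show ?thesis by (simp add: sum_norm_t flip: sum_distrib_right)
  qed
  \<comment> \<open>Since \<open>A k * B l\<close> depends on \<open>k + l\<close> alone, collecting
    the product by \<open>s = k + l\<close> makes each coefficient a convolution of the two
    coefficient sequences.\<close>
  define H where "H s = A s * B 0" for s
  have AB_H: "A k * B l = H (k + l)" for k l unfolding H_def by (rule AB)
  have H_mod: "H (s mod m) = H s" for s by (simp add: H_def per)
  have FG: "F r * G r = 0" for r
  proof -
    have conv: "(\<Sum>k\<in>I. t k * (t (s - k) * e (s - k))) = 0" for s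
    proof -
      have "(\<Sum>k\<in>I. t k * (t (s - k) * e (s - k))) =
        of_real (\<Sum>k\<in>{0..<4*L}. tent_coeff L k * (tent_coeff L (s - k) * (if even (s - k) then 1 else - 1)))"
        unfolding of_real_sum I_def m_def by (rule sum.cong[OF refl]) (simp add: t_def e_def)
      then show ?thesis by (simp only: tent_coeff_convolution[OF L] of_real_0)
    qed
    have "F r * G r = (\<Sum>k\<in>I. \<Sum>l\<in>I. (t k * (t l * e l) * w (r * (k + l))) *\<^sub>C H (k + l))"
      unfolding F_def G_def mult_sum_scaleC AB_H
      by (intro sum.cong refl) (simp add: w_def root_char_add distrib_left mult_ac)
    also have "\<dots> = (\<Sum>k\<in>I. \<Sum>s\<in>I. (t k * (t (s - k) * e (s - k)) * w (r * s)) *\<^sub>C H s)"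
    proof (rule sum.cong[OF refl])
      fix k
      let ?f = "\<lambda>s. (t k * (t (s - k) * e (s - k)) * w (r * s)) *\<^sub>C H s"
      have "?f (s mod m) = ?f s" for s
        using per(3)[of "r * s"] per(3)[of "r * (s mod m)"] per(4)[of "s - k"] per(4)[of "s mod m - k"]
          e_mod[of "s - k"] e_mod[of "s mod m - k"]
        by (simp add: H_mod mod_diff_left_eq mod_mult_right_eq)
      from sum_periodic_shift[of m ?f, OF m(1) this, of k]
      show "(\<Sum>l\<in>I. (t k * (t l * e l) * w (r * (k + l))) *\<^sub>C H (k + l)) = (\<Sum>s\<in>I. ?f s)"
        by (simp add: I_def add.commute)
    qed
    also have "\<dots> = (\<Sum>s\<in>I. ((\<Sum>k\<in>I. t k * (t (s - k) * e (s - k))) * w (r * s)) *\<^sub>C H s)"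
      by (subst sum.swap) (simp add: complex_vector.scale_sum_left sum_distrib_right)
    finally show ?thesis by (simp add: conv)
  qed
  \<comment> \<open>Summation over \<open>r\<close> kills all pairs except those with
    \<open>l = - k\<close> modulo \<open>m\<close>; there the two coefficients agree by symmetry of
    the tent, which yields the square.\<close>
  have "(\<Sum>r\<in>I. \<phi> (F r) (G r)) =
      (\<Sum>r\<in>I. \<Sum>k\<in>I. \<Sum>l\<in>I. w ((k + l) * r) * (e l * t k * t l * \<phi> (A k) (B l)))"
    unfolding F_def G_def bounded_cbilinear_sum[OF \<phi>]
    by (intro sum.cong refl) (simp add: w_def root_char_add distrib_left distrib_right mult_ac)
  also have "\<dots> = (\<Sum>k\<in>I. \<Sum>l\<in>I. \<Sum>r\<in>I. w ((k + l) * r) * (e l * t k * t l * \<phi> (A k) (B l)))"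
    by (subst sum.swap, rule sum.cong[OF refl]) (rule sum.swap)
  also have "\<dots> = (\<Sum>k\<in>I. \<Sum>l\<in>I. (if m dvd k + l then of_int m else 0) * (e l * t k * t l * \<phi> (A k) (B l)))"
    unfolding sum_distrib_right[symmetric] by (simp only: I_def w_def sum_root_char[OF m(1)])
  also have "\<dots> = (\<Sum>k\<in>I. of_int m * (e k * (t k)\<^sup>2 * \<phi> (A k) (B (- k))))"
  proof (rule sum.cong[OF refl])
    fix k assume k: "k \<in> I"
    have dvd: "m dvd k + l \<longleftrightarrow> l = (- k) mod m" if "l \<in> I" for l
    proof -
      have "m dvd k + l \<longleftrightarrow> l mod m = (- k) mod m"
        by (simp add: mod_eq_dvd_iff add.commute)
      then show ?thesis using that by (simp add: I_def)
    qed
    have "(\<Sum>l\<in>I. (if m dvd k + l then of_int m else 0) * (e l * t k * t l * \<phi> (A k) (B l)))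
      = (\<Sum>l\<in>I. if l = (- k) mod m then of_int m * (e l * t k * t l * \<phi> (A k) (B l)) else 0)"
      by (rule sum.cong[OF refl]) (simp add: dvd)
    also have "\<dots> = of_int m * (e (- k) * t k * t (- k) * \<phi> (A k) (B (- k)))"
      using m(1) by (subst sum.delta) (auto simp: I_def per e_mod)
    also have "\<dots> = of_int m * (e k * (t k)\<^sup>2 * \<phi> (A k) (B (- k)))"
      by (simp add: e_def t_def tent_coeff_minus power2_eq_square)
    finally show "(\<Sum>l\<in>I. (if m dvd k + l then of_int m else 0) * (e l * t k * t l * \<phi> (A k) (B l)))
      = of_int m * (e k * (t k)\<^sup>2 * \<phi> (A k) (B (- k)))" .
  qed
  also have "\<dots> = of_int m * (\<Sum>k\<in>{0..<4*L}. complex_of_real ((if even k then 1 else - 1) * (tent_coeff L k)\<^sup>2) * \<phi> (A k) (B (- k)))"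
    unfolding sum_distrib_left I_def m_def by (intro sum.cong refl) (simp add: e_def t_def)
  finally have avg: "(\<Sum>r\<in>I. \<phi> (F r) (G r)) = of_int m * (\<Sum>k\<in>{0..<4*L}. complex_of_real ((if even k then 1 else - 1) * (tent_coeff L k)\<^sup>2) * \<phi> (A k) (B (- k)))" 
    (is "_ = _ * ?R") .
  have "of_int m * cmod ?R = cmod (\<Sum>r\<in>I. \<phi> (F r) (G r))"
    unfolding avg norm_mult using m by simp
  also have "\<dots> \<le> (\<Sum>r\<in>I. zp_seminorm \<phi> * (\<alpha> * \<beta>))"
  proof (rule sum_norm_le)
    fix r
    have "cmod (\<phi> (F r) (G r)) \<le> zp_seminorm \<phi> * (norm (F r) * norm (G r))"
      by (rule cmod_le_zp_seminorm[OF \<phi> FG])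
    also have "\<dots> \<le> zp_seminorm \<phi> * (\<alpha> * \<beta>)"
      using order_trans[OF norm_ge_zero nA[of 0]]
      by (intro mult_left_mono mult_mono nF nG zp_seminorm_nonneg \<phi>) auto
    finally show "cmod (\<phi> (F r) (G r)) \<le> zp_seminorm \<phi> * (\<alpha> * \<beta>)" .
  qed
  also have "\<dots> = of_int m * (zp_seminorm \<phi> * (\<alpha> * \<beta>))"
    using m by (simp add: I_def)
  finally show ?thesis using m by simp
qed

lemma periodic_mod_mult:
  fixes m c k :: int
  assumes "\<And>k. f (k mod m) = f k" and "m dvd M"
  shows "f (i + c * (k mod M)) = f (i + c * k)"
proof -
  have "(i + c * (k mod M)) mod m = (i + c * k) mod m"
    by (intro mod_add_cong mod_mult_cong refl mod_mod_cancel assms(2))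
  then show ?thesis
    using assms(1)[of "i + c * (k mod M)"] assms(1)[of "i + c * k"] by simp
qed

text \<open>The weights \<open>s k\<close> sum to zero and are positive at even and nonpositive at
  odd frequencies, up to vanishing coefficients. Tested against the orbit through the two points of
  largest oscillation, frequency 1 outweighs the nonzero even frequencies.\<close>

lemma zero_product_rotation_bound:
  fixes \<phi> :: "'a::cbanach_algebra \<Rightarrow> 'a \<Rightarrow> complex" and A B :: "int \<Rightarrow> 'a"
  assumes \<phi>: "bounded_cbilinear \<phi>" and m: "m > 0"
    and perA: "\<And>k. A (k mod m) = A k" and perB: "\<And>k. B (k mod m) = B k"
    and AB: "\<And>k l. A k * B l = A (k + l) * B 0"
    and nA: "\<And>k. norm (A k) \<le> \<alpha>" and nB: "\<And>k. norm (B k) \<le> \<beta>"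
  shows "cmod (\<phi> (A 1) (B (- 1)) - \<phi> (A 0) (B 0)) \<le> 300 * (zp_seminorm \<phi> * (\<alpha> * \<beta>))"
proof -
  \<comment> \<open>This makes \<open>L\<close> even, as the estimate for the even coefficients
    requires, and makes \<open>4 * L\<close> a multiple of the period \<open>m\<close>.\<close>
  define L where "L = 2 * m"
  have L: "L > 0" "even L" using m by (auto simp: L_def)
  define E where "E = zp_seminorm \<phi> * (\<alpha> * \<beta>)"
  define \<psi> where "\<psi> k = \<phi> (A k) (B (- k))" for k
  have per: "\<psi> (k mod m) = \<psi> k" for k
    using perA perB[of "- k"] perB[of "- (k mod m)"] by (simp add: \<psi>_def mod_minus_eq)
  define s where "s k = (if even k then 1 else - 1) * (tent_coeff L k)\<^sup>2" for k
  have s_sum: "(\<Sum>k\<in>{0..<4*L}. s k) = 0"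
  proof -
    have "(\<Sum>k\<in>{0..<4*L}. s k) = (\<Sum>k\<in>{0..<4*L}. tent_coeff L k * (tent_coeff L (0 - k) * (if even (0 - k) then 1 else - 1)))"
      by (rule sum.cong[OF refl]) (simp add: s_def tent_coeff_minus power2_eq_square)
    then show ?thesis by (simp only: tent_coeff_convolution[OF L(1)])
  qed
  \<comment> \<open>The previous bound is applied along a progression: \<open>A (j + i * k)\<close>
    and \<open>B (- j + i * k)\<close> again satisfy the product rule, and the opposite starting
    points turn the pairing into \<open>\<psi> (j + i * k)\<close>.\<close>
  have small: "cmod (\<Sum>k\<in>{0..<4*L}. complex_of_real (s k) * \<psi> (j + i * k)) \<le> E" for j i
    unfolding \<psi>_def s_def E_def minus_add_distrib mult_minus_right[symmetric]
  proof (rule alternating_tent_squares_bound[OF \<phi> L(1), of "\<lambda>k. A (j + i * k)" "\<lambda>k. B (- j + i * k)" \<alpha> \<beta>])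
    have "m dvd 4 * L" by (simp add: L_def)
    then show "A (j + i * (k mod (4 * L))) = A (j + i * k)" "B (- j + i * (k mod (4 * L))) = B (- j + i * k)" for k
      using periodic_mod_mult[of A m, OF perA] periodic_mod_mult[of B m, OF perB] by blast+
    show "A (j + i * k) * B (- j + i * l) = A (j + i * (k + l)) * B (- j + i * 0)" for k l
      using AB[of "j + i * k" "- j + i * l"] AB[of "j + i * (k + l)" "- j"]
      by (simp add: algebra_simps)
  qed (rule nA nB)+
  \<comment> \<open>The maximum runs over all pairs of points in the period. This extremality forces
    \<open>d k\<close> below into the interval from 0 to \<open>D\<close>.\<close>
  define D where "D = Max ((\<lambda>(a, b). cmod (\<psi> a - \<psi> b)) ` ({0..<m} \<times> {0..<m}))"
  have D_ge: "cmod (\<psi> a - \<psi> b) \<le> D" for a b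
  proof -
    have "cmod (\<psi> (a mod m) - \<psi> (b mod m)) \<le> D"
      unfolding D_def using m by (intro Max_ge) auto
    then show ?thesis by (simp only: per)
  qed
  have "D \<in> (\<lambda>(a, b). cmod (\<psi> a - \<psi> b)) ` ({0..<m} \<times> {0..<m})"
    unfolding D_def by (rule Max_in) (use m in auto)
  then obtain a b where D_eq: "D = cmod (\<psi> a - \<psi> b)" by auto
  have "D \<le> 300 * E"
  proof -
    \<comment> \<open>A phase that turns the extremal difference into the nonnegative real number
      \<open>D\<close>.\<close>
    define v where "v = cnj (sgn (\<psi> a - \<psi> b))"
    have v1: "cmod v \<le> 1" by (simp add: v_def norm_sgn)
    have vD: "v * (\<psi> a - \<psi> b) = D"
      unfolding D_eq v_def sgn_eq
      by (simp add: mult.commute[of "cnj _"] power2_eq_square del: complex_cnj_diff flip: complex_norm_square)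
    define d where "d k = Re (v * (\<psi> a - \<psi> (a + (b - a) * k)))" for k
    have Re_le: "Re (v * z) \<le> cmod z" for z
      using complex_Re_le_cmod[of "v * z"] mult_right_mono[OF v1 norm_ge_zero[of z]]
      by (simp add: norm_mult)
    have d_le: "d k \<le> D" for k
      unfolding d_def using Re_le D_ge by (rule order_trans)
    have d_ge: "0 \<le> d k" for k
    proof -
      have "d k = D - Re (v * (\<psi> (a + (b - a) * k) - \<psi> b))"
        using arg_cong[OF vD, of Re] by (simp add: d_def algebra_simps)
      moreover have "Re (v * (\<psi> (a + (b - a) * k) - \<psi> b)) \<le> D"
        using Re_le D_ge by (rule order_trans)
      ultimately show ?thesis by simp
    qed
    have d0: "d 0 = 0" by (simp add: d_def)
    have d1: "d 1 = D" using vD by (simp add: d_def)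
    have "(\<Sum>k\<in>{0..<4*L}. s k * d k) = - Re (v * (\<Sum>k\<in>{0..<4*L}. complex_of_real (s k) * \<psi> (a + (b - a) * k)))"
    proof -
      have "(\<Sum>k\<in>{0..<4*L}. s k * d k) =
        (\<Sum>k\<in>{0..<4*L}. s k * Re (v * \<psi> a) - Re (v * (complex_of_real (s k) * \<psi> (a + (b - a) * k))))"
        by (rule sum.cong[OF refl]) (simp add: d_def algebra_simps)
      also have "\<dots> = (\<Sum>k\<in>{0..<4*L}. s k) * Re (v * \<psi> a)
        - Re (v * (\<Sum>k\<in>{0..<4*L}. complex_of_real (s k) * \<psi> (a + (b - a) * k)))"
        by (simp only: sum_subtractf sum_distrib_right sum_distrib_left Re_sum)
      finally show ?thesis by (simp only: s_sum)
    qed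
    also have "\<dots> = Re (v * (- (\<Sum>k\<in>{0..<4*L}. complex_of_real (s k) * \<psi> (a + (b - a) * k))))"
      by simp
    finally have "- E \<le> (\<Sum>k\<in>{0..<4*L}. s k * d k)"
      using Re_le[of "\<Sum>k\<in>{0..<4*L}. complex_of_real (s k) * \<psi> (a + (b - a) * k)"] small[of a "b - a"]
      by simp
    also have "\<dots> \<le> (\<Sum>k\<in>{0..<4*L}. (if k = 1 then - (tent_coeff L 1)\<^sup>2 * D else 0)
        + (if k \<in> {0<..<4*L} \<and> even k then (tent_coeff L k)\<^sup>2 * D else 0))"
    \<comment> \<open>The term at 0 vanishes since \<open>d 0 = 0\<close>, the term at 1 is kept
      exactly, the other odd terms are nonpositive and are dropped, and in the even ones
      \<open>d k\<close> is replaced by \<open>D\<close>.\<close>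
    proof (rule sum_mono)
      fix k assume k: "k \<in> {0..<4*L}"
      consider "k = 1" | "k = 0" | "k \<in> {0<..<4*L}" "even k" | "odd k" "k \<noteq> 1" using k by fastforce
      then show "s k * d k \<le> (if k = 1 then - (tent_coeff L 1)\<^sup>2 * D else 0)
        + (if k \<in> {0<..<4*L} \<and> even k then (tent_coeff L k)\<^sup>2 * D else 0)"
        by cases (auto simp: s_def d0 d1 d_ge d_le mult_left_mono)
    qed
    also have "\<dots> = (\<Sum>k\<in>{k\<in>{0<..<4*L}. even k}. (tent_coeff L k)\<^sup>2) * D - (tent_coeff L 1)\<^sup>2 * D"
    proof -
      have eq: "{k\<in>{0..<4*L}. k \<in> {0<..<4*L} \<and> even k} = {k\<in>{0<..<4*L}. even k}" by auto
      have "(\<Sum>k\<in>{0..<4*L}. if k \<in> {0<..<4*L} \<and> even k then (tent_coeff L k)\<^sup>2 * D else 0)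
        = (\<Sum>k\<in>{k\<in>{0<..<4*L}. even k}. (tent_coeff L k)\<^sup>2 * D)"
        unfolding eq[symmetric] by (rule sum.inter_filter[symmetric]) simp
      then show ?thesis
        using L(1) by (simp only: sum.distrib sum_distrib_right[symmetric]) simp
    qed
    also have "\<dots> \<le> 1 / 32 * D - (tent_coeff L 1)\<^sup>2 * D"
      using sum_tent_coeff_even_squares[OF L] by (intro diff_right_mono mult_right_mono) (auto simp: D_eq)
    finally have "((tent_coeff L 1)\<^sup>2 - 1 / 32) * D \<le> E" by (simp add: algebra_simps)
    moreover have "1 / 300 * D \<le> ((tent_coeff L 1)\<^sup>2 - 1 / 32) * D"
      by (rule mult_right_mono[OF tent_coeff_1_square_ge[OF L(1)]]) (simp add: D_eq)
    ultimately show ?thesis by simp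
  qed
  moreover have "cmod (\<psi> 1 - \<psi> 0) \<le> D" by (rule D_ge)
  ultimately show ?thesis by (simp add: \<psi>_def E_def)
qed

section \<open>Averages over finite groups\<close>

text \<open>The functional obtained by inserting the diagonal of the group algebra, the average of
  \<open>t\<close> tensor its inverse, into \<open>\<phi>\<close> after multiplying the left factor
  by \<open>c\<close>.\<close>

definition diagonal_average ::
    "('g, 'm) monoid_scheme \<Rightarrow> ('g \<Rightarrow> 'a::cbanach_algebra) \<Rightarrow> ('a \<Rightarrow> 'a \<Rightarrow> complex) \<Rightarrow> 'a \<Rightarrow> complex"
  where "diagonal_average G \<tau> \<phi> c = (\<Sum>t\<in>carrier G. \<phi> (c * \<tau> t) (\<tau> (inv\<^bsub>G\<^esub> t))) / of_nat (card (carrier G))"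

text \<open>The target may lack a unit, so \<open>\<tau>\<close> is required to be multiplicative
  and \<open>\<tau> \<one>\<close> is an idempotent. Hence estimates compare with the corner values
  at \<open>a * \<tau> \<one>\<close> and \<open>\<tau> \<one> * b\<close>.\<close>

locale finite_group_rep = group G for G :: "('g, 'm) monoid_scheme" (structure) +
  fixes \<tau> :: "'g \<Rightarrow> 'a::cbanach_algebra" and C :: real
  assumes fin: "finite (carrier G)"
    and rep_mult: "s \<in> carrier G \<Longrightarrow> t \<in> carrier G \<Longrightarrow> \<tau> (s \<otimes> t) = \<tau> s * \<tau> t"
    and rep_bound: "t \<in> carrier G \<Longrightarrow> norm (\<tau> t) \<le> C"
begin

lemma card_pos: "card (carrier G) > 0"
  using fin card_gt_0_iff by blast

lemma C_nonneg: "C \<ge> 0"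
  using rep_bound[OF one_closed] norm_ge_zero order_trans by blast

text \<open>The integer powers of \<open>t\<close> have period \<open>ord t\<close> and are again
  group elements, so \<open>C\<close> bounds them all and the rotation bound applies to
  \<open>a t^k\<close> and \<open>t^k b\<close>.\<close>

lemma rep_rotation_bound:
  assumes \<phi>: "bounded_cbilinear \<phi>" and t: "t \<in> carrier G"
  shows "cmod (\<phi> (a * \<tau> t) (\<tau> (inv t) * b) - \<phi> (a * \<tau> \<one>) (\<tau> \<one> * b))
    \<le> 300 * (zp_seminorm \<phi> * ((norm a * C) * (C * norm b)))"
proof -
  define A where "A k = a * \<tau> (t [^] (k::int))" for k
  define B where "B k = \<tau> (t [^] (k::int)) * b" for k
  have per: "t [^] (k mod int (ord t)) = t [^] k" for k :: int
    using t by (simp add: int_pow_eq mod_eq_dvd_iff[symmetric])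
  have "cmod (\<phi> (A 1) (B (- 1)) - \<phi> (A 0) (B 0)) \<le> 300 * (zp_seminorm \<phi> * ((norm a * C) * (C * norm b)))"
  proof (rule zero_product_rotation_bound[OF \<phi>, of "int (ord t)"])
    show "0 < int (ord t)" using ord_ge_1[OF fin t] by simp
    show "A (k mod int (ord t)) = A k" "B (k mod int (ord t)) = B k" for k
      by (simp_all add: A_def B_def per)
    show "A k * B l = A (k + l) * B 0" for k l
    proof -
      have "A k * B l = a * (\<tau> (t [^] k) * \<tau> (t [^] l)) * b"
        by (simp add: A_def B_def mult.assoc)
      also have "\<dots> = a * (\<tau> (t [^] (k + l)) * \<tau> (t [^] (0::int))) * b"
        using t by (simp add: int_pow_mult flip: rep_mult)
      finally show ?thesis by (simp add: A_def B_def mult.assoc)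
    qed
    show "norm (A k) \<le> norm a * C" for k
      unfolding A_def
      by (rule order_trans[OF norm_mult_ineq mult_left_mono[OF rep_bound]]) (use t in auto)
    show "norm (B k) \<le> C * norm b" for k
      unfolding B_def
      by (rule order_trans[OF norm_mult_ineq mult_right_mono[OF rep_bound]]) (use t in auto)
  qed
  then show ?thesis using t by (simp add: A_def B_def int_pow_neg)
qed

text \<open>The defining property of a diagonal: for a group element \<open>s\<close>, replacing
  \<open>t\<close> by the inverse of \<open>s\<close> times \<open>t\<close> moves \<open>s\<close>
  from the left factor to the right one. Linearity extends this to the span.\<close>

lemma diagonal_average_shift:
  assumes \<phi>: "bounded_cbilinear \<phi>"
  shows "(\<Sum>t\<in>carrier G. \<phi> (a * (\<Sum>s\<in>carrier G. c s *\<^sub>C \<tau> s) * \<tau> t) (\<tau> (inv t))) =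
    (\<Sum>t\<in>carrier G. \<phi> (a * \<tau> t) (\<tau> (inv t) * (\<Sum>s\<in>carrier G. c s *\<^sub>C \<tau> s)))"
proof -
  interpret bounded_bilinear \<phi> using \<phi> by (simp add: bounded_cbilinear_def)
  have sc: "\<phi> (z *\<^sub>C a) b = z * \<phi> a b" "\<phi> a (z *\<^sub>C b) = z * \<phi> a b" for z a b
    using \<phi> by (simp_all add: bounded_cbilinear_def)
  have "(\<Sum>t\<in>carrier G. \<phi> (a * (\<Sum>s\<in>carrier G. c s *\<^sub>C \<tau> s) * \<tau> t) (\<tau> (inv t))) =
      (\<Sum>t\<in>carrier G. \<Sum>s\<in>carrier G. c s * \<phi> (a * \<tau> (s \<otimes> t)) (\<tau> (inv t)))"
    by (simp add: sum_distrib_left sum_distrib_right sum_left sc mult_scaleC_left mult_scaleC_right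
        rep_mult mult.assoc)
  also have "\<dots> = (\<Sum>s\<in>carrier G. \<Sum>t\<in>carrier G. c s * \<phi> (a * \<tau> (s \<otimes> t)) (\<tau> (inv t)))"
    by (rule sum.swap)
  also have "\<dots> = (\<Sum>s\<in>carrier G. \<Sum>t\<in>carrier G. c s * \<phi> (a * \<tau> t) (\<tau> (inv t \<otimes> s)))"
  proof (rule sum.cong[OF refl])
    fix s assume s: "s \<in> carrier G"
    show "(\<Sum>t\<in>carrier G. c s * \<phi> (a * \<tau> (s \<otimes> t)) (\<tau> (inv t)))
      = (\<Sum>t\<in>carrier G. c s * \<phi> (a * \<tau> t) (\<tau> (inv t \<otimes> s)))"
      by (rule sum.reindex_bij_witness[where i = "\<lambda>t. inv s \<otimes> t" and j = "\<lambda>t. s \<otimes> t"])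
        (use s in \<open>auto simp: inv_mult_group m_assoc[symmetric]\<close>, auto simp: m_assoc)
  qed
  also have "\<dots> = (\<Sum>t\<in>carrier G. \<Sum>s\<in>carrier G. c s * \<phi> (a * \<tau> t) (\<tau> (inv t \<otimes> s)))"
    by (rule sum.swap)
  also have "\<dots> = (\<Sum>t\<in>carrier G. \<phi> (a * \<tau> t) (\<tau> (inv t) * (\<Sum>s\<in>carrier G. c s *\<^sub>C \<tau> s)))"
    by (simp add: sum_distrib_left sum_right sc mult_scaleC_right rep_mult)
  finally show ?thesis .
qed

text \<open>After the shift, every summand is a rotation of the pair at the identity, and each
  rotation costs at most the same bound.\<close>

lemma diagonal_average_close:
  assumes \<phi>: "bounded_cbilinear \<phi>" and b: "b = (\<Sum>s\<in>carrier G. c s *\<^sub>C \<tau> s)"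
  shows "cmod (diagonal_average G \<tau> \<phi> (a * b) - \<phi> (a * \<tau> \<one>) (\<tau> \<one> * b))
    \<le> 300 * (zp_seminorm \<phi> * ((norm a * C) * (C * norm b)))"
proof -
  let ?n = "of_nat (card (carrier G)) :: complex" and ?K = "300 * (zp_seminorm \<phi> * ((norm a * C) * (C * norm b)))"
  have n: "?n \<noteq> 0" using card_pos by simp
  have "diagonal_average G \<tau> \<phi> (a * b) - \<phi> (a * \<tau> \<one>) (\<tau> \<one> * b) =
    (\<Sum>t\<in>carrier G. \<phi> (a * \<tau> t) (\<tau> (inv t) * b) - \<phi> (a * \<tau> \<one>) (\<tau> \<one> * b)) / ?n"
    using n unfolding diagonal_average_def b diagonal_average_shift[OF \<phi>] sum_subtractf
    by (simp add: field_simps)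
  then have "cmod (diagonal_average G \<tau> \<phi> (a * b) - \<phi> (a * \<tau> \<one>) (\<tau> \<one> * b)) =
    cmod (\<Sum>t\<in>carrier G. \<phi> (a * \<tau> t) (\<tau> (inv t) * b) - \<phi> (a * \<tau> \<one>) (\<tau> \<one> * b)) / card (carrier G)"
    by (simp add: norm_divide)
  also have "\<dots> \<le> (\<Sum>t\<in>carrier G. ?K) / card (carrier G)"
    by (intro divide_right_mono sum_norm_le rep_rotation_bound[OF \<phi>]) auto
  also have "\<dots> = ?K" using card_pos by simp
  finally show ?thesis .
qed

lemma clinear_diagonal_average:
  assumes "bounded_cbilinear \<phi>"
  shows "clinear (diagonal_average G \<tau> \<phi>)"
proof -
  interpret bounded_bilinear \<phi> using assms by (simp add: bounded_cbilinear_def)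
  have sc: "\<phi> (z *\<^sub>C a) b = z * \<phi> a b" for z a b
    using assms by (simp add: bounded_cbilinear_def)
  show ?thesis
    by (simp add: clinear_def diagonal_average_def distrib_right add_left sum.distrib
        add_divide_distrib mult_scaleC_left sc scaleC_complex_def flip: sum_distrib_left)
qed

text \<open>A bound independent of the group, so that the averages along a net stay in a fixed ball
  of the dual.\<close>

lemma diagonal_average_bound:
  assumes "\<And>a b. cmod (\<phi> a b) \<le> norm a * norm b * K" "K \<ge> 0"
  shows "cmod (diagonal_average G \<tau> \<phi> c) \<le> norm c * (C * C * K)"
proof -
  have "cmod (diagonal_average G \<tau> \<phi> c) = cmod (\<Sum>t\<in>carrier G. \<phi> (c * \<tau> t) (\<tau> (inv t))) / card (carrier G)"
    by (simp add: diagonal_average_def norm_divide)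
  also have "\<dots> \<le> (\<Sum>t\<in>carrier G. norm c * (C * C * K)) / card (carrier G)"
  proof (intro divide_right_mono sum_norm_le)
    fix t assume t: "t \<in> carrier G"
    have "norm (c * \<tau> t) \<le> norm c * C"
      by (rule order_trans[OF norm_mult_ineq mult_left_mono[OF rep_bound]]) (use t in auto)
    then have "norm (c * \<tau> t) * norm (\<tau> (inv t)) * K \<le> (norm c * C) * C * K"
      by (intro mult_right_mono mult_mono rep_bound) (use t assms(2) C_nonneg in auto)
    with assms(1)[of "c * \<tau> t" "\<tau> (inv t)"]
    show "cmod (\<phi> (c * \<tau> t) (\<tau> (inv t))) \<le> norm c * (C * C * K)"
      by (simp add: mult_ac)
  qed simp
  also have "\<dots> = norm c * (C * C * K)" using card_pos by simp
  finally show ?thesis .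
qed

end

section \<open>Limit functionals and the distance to product functionals\<close>

lemma compact_PiE_UNIV:
  fixes S :: "'b \<Rightarrow> 'c::topological_space set"
  assumes "\<And>i. compact (S i)"
  shows "compact (PiE UNIV S)"
proof -
  have "compactin (product_topology (\<lambda>_. euclidean) UNIV) (PiE UNIV S)"
    unfolding compactin_PiE using assms by simp
  then show ?thesis by (simp add: euclidean_product_topology)
qed

text \<open>Pointwise cluster points of bounded nets of functionals exist by Tychonoff's theorem.\<close>

lemma cluster_functional:
  fixes \<xi> :: "'l \<Rightarrow> 'b::complex_normed_vector \<Rightarrow> complex"
  assumes F: "F \<noteq> bot"
    and lin: "eventually (\<lambda>l. clinear (\<xi> l)) F"
    and bd: "eventually (\<lambda>l. \<forall>c. cmod (\<xi> l c) \<le> norm c * M) F"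
  obtains \<zeta> where "clinear \<zeta>" "\<And>c. cmod (\<zeta> c) \<le> norm c * M"
    "\<And>c z r. (\<And>\<eta>. \<eta> > 0 \<Longrightarrow> eventually (\<lambda>l. cmod (\<xi> l c - z) \<le> r + \<eta>) F) \<Longrightarrow> cmod (\<zeta> c - z) \<le> r"
proof -
  let ?U = "PiE UNIV (\<lambda>c::'b. cball (0::complex) (norm c * M))"
  have "compact ?U" by (rule compact_PiE_UNIV) simp
  moreover have "eventually (\<lambda>f. f \<in> ?U) (filtermap \<xi> F)"
    using bd by (simp add: eventually_filtermap PiE_def Pi_def extensional_def)
  moreover have "filtermap \<xi> F \<noteq> bot" using F by (simp add: filtermap_bot_iff)
  ultimately obtain \<zeta> where \<zeta>: "\<zeta> \<in> ?U" "inf (nhds \<zeta>) (filtermap \<xi> F) \<noteq> bot"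
    unfolding compact_filter by blast
  \<comment> \<open>A cluster point lies in every closed set that eventually contains the net.
    Linearity and the estimates are each closed conditions on finitely many coordinates.\<close>
  have mem: "\<zeta> \<in> S" if "closed S" "eventually (\<lambda>l. \<xi> l \<in> S) F" for S
  proof (rule ccontr)
    assume "\<zeta> \<notin> S"
    then have "eventually (\<lambda>f. f \<in> - S) (nhds \<zeta>)"
      using \<open>closed S\<close> by (intro eventually_nhds_in_open) auto
    moreover have "eventually (\<lambda>f. f \<in> S) (filtermap \<xi> F)"
      using that(2) by (simp add: eventually_filtermap)
    ultimately have "eventually (\<lambda>f. False) (inf (nhds \<zeta>) (filtermap \<xi> F))"
      unfolding eventually_inf by fastforce
    then show False using \<zeta>(2) by (simp add: eventually_False)
  qed
  have ev: "continuous_on UNIV (\<lambda>f::'b \<Rightarrow> complex. f c)" for c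
    by (rule continuous_on_product_coordinates)
  show ?thesis
  proof
    show "clinear \<zeta>"
      unfolding clinear_def
    proof safe
      fix x y
      have "closed {f::'b \<Rightarrow> complex. f (x + y) = f x + f y}"
        by (intro closed_Collect_eq continuous_intros ev)
      moreover have "eventually (\<lambda>l. \<xi> l \<in> {f. f (x + y) = f x + f y}) F"
        using lin by (rule eventually_mono) (simp add: clinear_def)
      ultimately show "\<zeta> (x + y) = \<zeta> x + \<zeta> y" using mem by blast
    next
      fix z x
      have "closed {f::'b \<Rightarrow> complex. f (z *\<^sub>C x) = z *\<^sub>C f x}"
        unfolding scaleC_complex_def by (intro closed_Collect_eq continuous_intros ev)
      moreover have "eventually (\<lambda>l. \<xi> l \<in> {f. f (z *\<^sub>C x) = z *\<^sub>C f x}) F"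
        using lin by (rule eventually_mono) (simp add: clinear_def)
      ultimately show "\<zeta> (z *\<^sub>C x) = z *\<^sub>C \<zeta> x" using mem by blast
    qed
    show "cmod (\<zeta> c) \<le> norm c * M" for c
      using \<zeta>(1) by (simp add: PiE_def Pi_def extensional_def)
    show "cmod (\<zeta> c - z) \<le> r"
      if "\<And>\<eta>. \<eta> > 0 \<Longrightarrow> eventually (\<lambda>l. cmod (\<xi> l c - z) \<le> r + \<eta>) F" for c z r
    proof (rule field_le_epsilon)
      fix \<eta> :: real assume "\<eta> > 0"
      have "closed {f::'b \<Rightarrow> complex. cmod (f c - z) \<le> r + \<eta>}"
        by (intro closed_Collect_le continuous_intros ev)
      from mem[OF this] show "cmod (\<zeta> c - z) \<le> r + \<eta>"
        using that[OF \<open>\<eta> > 0\<close>] by simp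
    qed
  qed
qed

section \<open>The distance to product functionals and the balance seminorm\<close>

lemma sup0_le:
  assumes "\<And>s. s \<in> S \<Longrightarrow> s \<le> K" "K \<ge> 0"
  shows "sup0 S \<le> K"
  using assms by (auto simp: sup0_def intro: cSup_least)

lemma norm_bil_le:
  assumes "\<And>a b. norm a = 1 \<Longrightarrow> norm b = 1 \<Longrightarrow> cmod (\<phi> a b) \<le> K" "K \<ge> 0"
  shows "norm_bil \<phi> \<le> K"
  unfolding norm_bil_def by (rule sup0_le) (use assms in auto)

lemma cmod_le_norm_bil:
  assumes K: "\<And>a b. cmod (\<phi> a b) \<le> norm a * norm b * K" and "norm a = 1" "norm b = 1"
  shows "cmod (\<phi> a b) \<le> norm_bil \<phi>"
proof -
  let ?S = "{cmod (\<phi> a b) | a b. norm a = 1 \<and> norm b = 1}"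
  have "bdd_above ?S"
  proof (rule bdd_aboveI[of _ K])
    fix s assume "s \<in> ?S"
    then obtain a b where "s = cmod (\<phi> a b)" "norm a = 1" "norm b = 1" by auto
    with K[of a b] show "s \<le> K" by simp
  qed
  moreover have mem: "cmod (\<phi> a b) \<in> ?S" using assms by blast
  ultimately have "cmod (\<phi> a b) \<le> Sup ?S" by (intro cSup_upper)
  then show ?thesis unfolding norm_bil_def sup0_def using mem by auto
qed

lemma bounded_bilinear_diff_product:
  fixes \<phi> :: "'a::cbanach_algebra \<Rightarrow> 'a \<Rightarrow> complex"
  assumes "bounded_cbilinear \<phi>" "\<psi> \<in> product_functionals"
  obtains K where "\<And>a b. cmod (\<phi> a b - \<psi> a b) \<le> norm a * norm b * K"
proof -
  obtain \<xi> :: "'a \<Rightarrow>\<^sub>L complex" where \<xi>: "\<psi> = (\<lambda>a b. blinfun_apply \<xi> (a * b))"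
    using assms(2) by (auto simp: product_functionals_def)
  obtain K where K: "\<And>a b. cmod (\<phi> a b) \<le> norm a * norm b * K"
    using assms(1) bounded_bilinear.bounded unfolding bounded_cbilinear_def by blast
  have "cmod (\<phi> a b - \<psi> a b) \<le> norm a * norm b * (K + norm \<xi>)" for a b
  proof -
    have "cmod (\<psi> a b) \<le> norm \<xi> * (norm a * norm b)"
      unfolding \<xi> by (rule order_trans[OF norm_blinfun mult_left_mono[OF norm_mult_ineq]]) simp
    then show ?thesis
      using norm_triangle_ineq4[of "\<phi> a b" "\<psi> a b"] K[of a b] by (simp add: algebra_simps)
  qed
  then show ?thesis using that by blast
qed

text \<open>Supplies the lower bound that the infimum in \<open>dist_product\<close> needs. In an
  algebra without unit vectors the default value 0 of \<open>sup0\<close> takes over.\<close>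

lemma norm_bil_diff_product_nonneg:
  fixes \<phi> :: "'a::cbanach_algebra \<Rightarrow> 'a \<Rightarrow> complex"
  assumes "bounded_cbilinear \<phi>" "\<psi> \<in> product_functionals"
  shows "0 \<le> norm_bil (\<lambda>a b. \<phi> a b - \<psi> a b)"
proof (cases "\<exists>(a::'a) b::'a. norm a = 1 \<and> norm b = 1")
  case True
  then obtain a b :: 'a where ab: "norm a = 1" "norm b = 1" by blast
  obtain K where "\<And>a b. cmod (\<phi> a b - \<psi> a b) \<le> norm a * norm b * K"
    using bounded_bilinear_diff_product[OF assms] by blast
  from cmod_le_norm_bil[of "\<lambda>a b. \<phi> a b - \<psi> a b", OF this ab] show ?thesis
    by (rule order_trans[OF norm_ge_zero])
next
  case False
  then have "{cmod (\<phi> a b - \<psi> a b) | a b. norm a = 1 \<and> norm b = 1} = {}" by blast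
  then show ?thesis by (simp only: norm_bil_def sup0_def) simp
qed

lemma zero_in_product_functionals: "(\<lambda>a b. 0) \<in> product_functionals"
proof -
  have "(0 :: 'a::cbanach_algebra \<Rightarrow>\<^sub>L complex) \<in> cblinfuns"
    by (simp add: cblinfuns_def clinear_def scaleC_complex_def)
  then show ?thesis unfolding product_functionals_def by force
qed

lemma dist_product_le:
  fixes \<phi> :: "'a::cbanach_algebra \<Rightarrow> 'a \<Rightarrow> complex"
  assumes \<phi>: "bounded_cbilinear \<phi>" and \<zeta>: "clinear \<zeta>" "\<And>c. cmod (\<zeta> c) \<le> norm c * M"
    and close: "\<And>a b. cmod (\<zeta> (a * b) - \<phi> a b) \<le> norm a * norm b * K" and K: "K \<ge> 0"
  shows "dist_product \<phi> \<le> K"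
proof -
  have "bounded_linear \<zeta>"
    by (rule bounded_linear_intro[of _ M])
      (use \<zeta> in \<open>simp_all add: clinear_def scaleR_scaleC\<close>)
  then have ap: "blinfun_apply (Blinfun \<zeta>) = \<zeta>" by (rule bounded_linear_Blinfun_apply)
  then have mem: "(\<lambda>a b. \<zeta> (a * b)) \<in> product_functionals"
    unfolding product_functionals_def cblinfuns_def using \<zeta>(1)
    by (intro CollectI exI[of _ "Blinfun \<zeta>"]) simp
  have "dist_product \<phi> \<le> norm_bil (\<lambda>a b. \<phi> a b - \<zeta> (a * b))"
    unfolding dist_product_def
    by (rule cINF_lower2[OF _ mem order_refl])
      (auto intro!: bdd_belowI[of _ 0] norm_bil_diff_product_nonneg[OF \<phi>])
  also have "\<dots> \<le> K"
  proof (rule norm_bil_le[OF _ K])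
    fix a b :: 'a assume "norm a = 1" "norm b = 1"
    with close[of a b] show "cmod (\<phi> a b - \<zeta> (a * b)) \<le> K" by (simp add: norm_minus_commute)
  qed
  finally show ?thesis .
qed

text \<open>Product functionals are balanced by associativity, so subtracting one from
  \<open>\<phi>\<close> leaves \<open>\<phi> (a * b) c - \<phi> a (b * c)\<close> unchanged. Two
  values of the difference then account for the factor 2.\<close>

lemma balance_seminorm_le_dist_product:
  fixes \<phi> :: "'a::cbanach_algebra \<Rightarrow> 'a \<Rightarrow> complex"
  assumes \<phi>: "bounded_cbilinear \<phi>"
  shows "balance_seminorm \<phi> \<le> 2 * dist_product \<phi>"
proof -
  have "balance_seminorm \<phi> / 2 \<le> norm_bil (\<lambda>a b. \<phi> a b - \<psi> a b)" (is "_ \<le> ?N")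
    if \<psi>: "\<psi> \<in> product_functionals" for \<psi>
  proof -
    obtain K where K: "\<And>a b. cmod (\<phi> a b - \<psi> a b) \<le> norm a * norm b * K"
      using bounded_bilinear_diff_product[OF \<phi> \<psi>] by blast
    have N0: "0 \<le> ?N" by (rule norm_bil_diff_product_nonneg[OF \<phi> \<psi>])
    obtain \<xi> :: "'a \<Rightarrow>\<^sub>L complex" where \<xi>: "\<psi> = (\<lambda>a b. blinfun_apply \<xi> (a * b))"
      using \<psi> by (auto simp: product_functionals_def)
    interpret \<phi>: bounded_bilinear \<phi> using \<phi> by (simp add: bounded_cbilinear_def)
    interpret D: bounded_bilinear "\<lambda>a b. \<phi> a b - \<psi> a b"
    proof
      show "\<exists>K. \<forall>a b. norm (\<phi> a b - \<psi> a b) \<le> norm a * norm b * K" using K by blast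
    qed (simp_all add: \<xi> \<phi>.add_left \<phi>.add_right \<phi>.scaleR_left \<phi>.scaleR_right distrib_left
        distrib_right blinfun.add_right blinfun.scaleR_right algebra_simps)
    have le: "cmod (\<phi> a b - \<psi> a b) \<le> ?N * (norm a * norm b)" for a b
    proof (cases "a = 0 \<or> b = 0")
      case True
      then show ?thesis using D.zero_left D.zero_right by auto
    next
      case False
      then have "norm (a /\<^sub>R norm a) = 1" "norm (b /\<^sub>R norm b) = 1" by simp_all
      from cmod_le_norm_bil[of "\<lambda>a b. \<phi> a b - \<psi> a b", OF K this]
      have "cmod (\<phi> a b - \<psi> a b) / norm a / norm b \<le> ?N"
        by (simp only: D.scaleR_left D.scaleR_right) (simp add: divide_inverse mult_ac)
      then show ?thesis using False by (simp add: field_simps)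
    qed
    have "cmod (\<phi> (a * b) c - \<phi> a (b * c)) \<le> 2 * ?N" if "norm a = 1" "norm b = 1" "norm c = 1" for a b c
    proof -
      have "\<phi> (a * b) c - \<phi> a (b * c) = (\<phi> (a * b) c - \<psi> (a * b) c) - (\<phi> a (b * c) - \<psi> a (b * c))"
        by (simp add: \<xi> mult.assoc)
      then have "cmod (\<phi> (a * b) c - \<phi> a (b * c)) \<le> cmod (\<phi> (a * b) c - \<psi> (a * b) c) + cmod (\<phi> a (b * c) - \<psi> a (b * c))"
        by (simp only: norm_triangle_ineq4)
      also have "\<dots> \<le> ?N * (norm (a * b) * norm c) + ?N * (norm a * norm (b * c))"
        by (intro add_mono le)
      also have "\<dots> \<le> ?N * (1 * 1) + ?N * (1 * 1)"
        using that norm_mult_ineq[of a b] norm_mult_ineq[of b c] N0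
        by (intro add_mono mult_left_mono mult_mono) auto
      finally show ?thesis by simp
    qed
    then have "balance_seminorm \<phi> \<le> 2 * ?N"
      unfolding balance_seminorm_def by (intro sup0_le) (use N0 in auto)
    then show ?thesis by simp
  qed
  then have "balance_seminorm \<phi> / 2 \<le> dist_product \<phi>"
    unfolding dist_product_def using zero_in_product_functionals by (intro cINF_greatest) auto
  then show ?thesis by simp
qed

lemma strong_B_consts_double:
  "\<alpha> \<in> szpd_consts A \<Longrightarrow> 2 * \<alpha> \<in> strong_B_consts A"
  unfolding szpd_consts_def strong_B_consts_def
  using balance_seminorm_le_dist_product by fastforce

lemma half_beta_const_le_alpha_const:
  assumes "strongly_zero_product_determined A"
  shows "strong_property_B A" "(1 / 2) * beta_const A \<le> alpha_const A"
proof -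
  have mem: "2 * alpha_const A \<in> strong_B_consts A"
    by (rule strong_B_consts_double[OF alpha_const_mem[OF assms]])
  then show "strong_property_B A" unfolding strong_property_B_def by blast
  have "beta_const A \<le> 2 * alpha_const A"
    unfolding beta_const_def
    by (rule cInf_lower[OF mem]) (auto simp: strong_B_consts_def intro!: bdd_belowI[of _ 0])
  then show "(1 / 2) * beta_const A \<le> alpha_const A" by simp
qed

text \<open>The abstract criterion: the group identities form an approximate identity and their
  corners are spanned by the groups. The diagonal averages then almost represent
  \<open>\<phi>\<close>, and a cluster point of them represents it up to the stated error.\<close>

lemma szpd_const_of_finite_group_reps:
  fixes F :: "'l filter" and G :: "'l \<Rightarrow> ('g, 'm) monoid_scheme" and \<tau> :: "'l \<Rightarrow> 'g \<Rightarrow> 'a::cbanach_algebra"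
  assumes F: "F \<noteq> bot" and C: "C \<ge> 0"
    and rep: "\<forall>\<^sub>F l in F. finite_group_rep (G l) (\<tau> l) C"
    and right: "\<And>a. ((\<lambda>l. a * \<tau> l \<one>\<^bsub>G l\<^esub>) \<longlongrightarrow> a) F"
    and both: "\<And>b. ((\<lambda>l. \<tau> l \<one>\<^bsub>G l\<^esub> * b * \<tau> l \<one>\<^bsub>G l\<^esub>) \<longlongrightarrow> b) F"
    and span: "\<And>b. \<forall>\<^sub>F l in F. \<exists>c. \<tau> l \<one>\<^bsub>G l\<^esub> * b * \<tau> l \<one>\<^bsub>G l\<^esub> = (\<Sum>s\<in>carrier (G l). c s *\<^sub>C \<tau> l s)"
  shows "300 * C\<^sup>2 \<in> szpd_consts TYPE('a)"
proof -
  have "dist_product \<phi> \<le> 300 * C\<^sup>2 * zp_seminorm \<phi>" if \<phi>: "bounded_cbilinear \<phi>" for \<phi> :: "'a \<Rightarrow> 'a \<Rightarrow> complex"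
  proof -
    interpret bounded_bilinear \<phi> using \<phi> by (simp add: bounded_cbilinear_def)
    obtain K where K: "K \<ge> 0" "\<And>a b. cmod (\<phi> a b) \<le> norm a * norm b * K"
      using nonneg_bounded by blast
    define \<xi> where "\<xi> l = diagonal_average (G l) (\<tau> l) \<phi>" for l
    define e where "e l = \<tau> l \<one>\<^bsub>G l\<^esub>" for l
    define Z where "Z = 300 * C\<^sup>2 * zp_seminorm \<phi>"
    have Z0: "Z \<ge> 0" by (simp add: Z_def zp_seminorm_nonneg[OF \<phi>])
    have lin: "\<forall>\<^sub>F l in F. clinear (\<xi> l)"
      using rep by (rule eventually_mono) (simp add: \<xi>_def finite_group_rep.clinear_diagonal_average \<phi>)
    have bd: "\<forall>\<^sub>F l in F. \<forall>c. cmod (\<xi> l c) \<le> norm c * (C * C * K)"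
      using rep by (rule eventually_mono)
        (auto simp: \<xi>_def intro!: finite_group_rep.diagonal_average_bound K)
    have close: "\<forall>\<^sub>F l in F. cmod (\<xi> l (a * b) - \<phi> a b) \<le> norm a * norm b * Z + \<eta>"
      if \<eta>: "\<eta> > 0" for a b :: 'a and \<eta> :: real
    proof -
      define b' where "b' l = e l * b * e l" for l
      have b': "(b' \<longlongrightarrow> b) F" using both by (simp add: b'_def[abs_def] e_def)
      \<comment> \<open>Three errors: replacing \<open>b\<close> by its compression under the
        bounded functional \<open>\<xi> l\<close>, the rotation bound for the compressed element,
        and the continuity of \<open>\<phi>\<close>. The first and the last tend to 0.\<close>
      define r where "r l = norm (a * (b - b' l)) * (C * C * K) + norm a * norm (b' l) * Z
        + cmod (\<phi> (a * e l) (b' l) - \<phi> a b)" for l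
      have "(r \<longlongrightarrow> norm (a * (b - b)) * (C * C * K) + norm a * norm b * Z + cmod (\<phi> a b - \<phi> a b)) F"
        unfolding r_def[abs_def] e_def by (intro tendsto_intros tendsto b' right)
      then have "\<forall>\<^sub>F l in F. r l < norm a * norm b * Z + \<eta>"
        using \<eta> by (intro order_tendstoD(2)) auto
      then show ?thesis
        using lin bd rep span[of b]
      proof eventually_elim
        case (elim l)
        interpret R: finite_group_rep "G l" "\<tau> l" C by (rule elim)
        \<comment> \<open>Idempotence of \<open>e l\<close> removes the identity on the right factor
          in the diagonal estimate; the one on the left factor is absorbed in the limit.\<close>
        have eb: "e l * b' l = b' l"
          by (simp add: b'_def e_def flip: mult.assoc R.rep_mult)
        obtain c where "b' l = (\<Sum>s\<in>carrier (G l). c s *\<^sub>C \<tau> l s)"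
          using elim(5) by (auto simp: b'_def e_def)
        from R.diagonal_average_close[OF \<phi> this, of a]
        have 1: "cmod (\<xi> l (a * b' l) - \<phi> (a * e l) (b' l)) \<le> norm a * norm (b' l) * Z"
          using eb by (simp add: \<xi>_def e_def Z_def power2_eq_square mult_ac)
        have "\<xi> l (a * b) = \<xi> l (a * (b - b' l)) + \<xi> l (a * b' l)"
          using elim(2) unfolding clinear_def
          by (metis diff_add_cancel distrib_left)
        then have "\<xi> l (a * b) - \<phi> a b = \<xi> l (a * (b - b' l)) + (\<xi> l (a * b' l) - \<phi> (a * e l) (b' l))
            + (\<phi> (a * e l) (b' l) - \<phi> a b)"
          by simp
        then have "cmod (\<xi> l (a * b) - \<phi> a b) \<le> cmod (\<xi> l (a * (b - b' l)))
            + cmod (\<xi> l (a * b' l) - \<phi> (a * e l) (b' l)) + cmod (\<phi> (a * e l) (b' l) - \<phi> a b)"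
          by (simp only:) (intro norm_triangle_le add_right_mono norm_triangle_ineq)
        also have "\<dots> \<le> r l"
          unfolding r_def using elim(3) 1 by (intro add_mono) auto
        finally show ?case using elim(1) by simp
      qed
    qed
    obtain \<zeta> where \<zeta>: "clinear \<zeta>" "\<And>c. cmod (\<zeta> c) \<le> norm c * (C * C * K)"
      and lim: "\<And>c z r. (\<And>\<eta>. \<eta> > 0 \<Longrightarrow> \<forall>\<^sub>F l in F. cmod (\<xi> l c - z) \<le> r + \<eta>) \<Longrightarrow> cmod (\<zeta> c - z) \<le> r"
      by (rule cluster_functional[OF F lin bd]) blast
    have "dist_product \<phi> \<le> Z"
      by (rule dist_product_le[OF \<phi> \<zeta> lim[OF close] Z0])
    then show ?thesis by (simp add: Z_def)
  qed
  then show ?thesis using C by (simp add: szpd_consts_def)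
qed

section \<open>Approximate identities for approximable operators\<close>

text \<open>By independence the norm has a positive minimum over the compact set of coefficients
  bounded by 1 with one coefficient equal to 1. Scaling by the largest coefficient gives the general
  case.\<close>

lemma finite_independent_norm_equivalence:
  fixes S :: "'a::complex_normed_vector set"
  assumes "finite S" and ind: "\<not> complex_vector.dependent S"
  obtains \<delta> where "\<delta> > 0" "\<And>c s. s \<in> S \<Longrightarrow> \<delta> * cmod (c s) \<le> norm (\<Sum>s\<in>S. c s *\<^sub>C s)"
proof -
  let ?f = "\<lambda>c. norm (\<Sum>s\<in>S. c s *\<^sub>C s)"
  define K where "K s = PiE UNIV (\<lambda>i::'a. if i = s then {1} else cball (0::complex) 1)" for s
  have cont: "continuous_on A ?f" for A
    by (intro continuous_intros bounded_linear.continuous_on[OF bounded_linear_scaleC_left]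
        continuous_on_subset[OF continuous_on_product_coordinates]) auto
  have "\<exists>d>0. \<forall>c\<in>K s. d \<le> ?f c" if s: "s \<in> S" for s
  proof -
    have comp: "compact (K s)" unfolding K_def by (rule compact_PiE_UNIV) auto
    have "(\<lambda>_. 1) \<in> K s" by (auto simp: K_def PiE_def)
    then have "K s \<noteq> {}" by blast
    from continuous_attains_inf[OF comp this cont]
    obtain c where c: "c \<in> K s" "\<forall>c'\<in>K s. ?f c \<le> ?f c'" by (elim bexE)
    have "c s = 1" using c(1) by (auto simp: K_def PiE_def Pi_def split: if_splits)
    have "(\<Sum>s\<in>S. c s *\<^sub>C s) \<noteq> 0"
    proof
      assume "(\<Sum>s\<in>S. c s *\<^sub>C s) = 0"
      moreover have "\<exists>v\<in>S. c v \<noteq> 0" using s \<open>c s = 1\<close> by (intro bexI[of _ s]) simp_all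
      ultimately show False
        using ind unfolding complex_vector.dependent_finite[OF \<open>finite S\<close>] by blast
    qed
    then show ?thesis using c(2) by (intro exI[of _ "?f c"]) auto
  qed
  then obtain d where d: "\<And>s. s \<in> S \<Longrightarrow> d s > 0" "\<And>s c. s \<in> S \<Longrightarrow> c \<in> K s \<Longrightarrow> d s \<le> ?f c"
    by metis
  define \<delta> where "\<delta> = Min (insert 1 (d ` S))"
  have \<delta>0: "\<delta> > 0" using \<open>finite S\<close> d(1) by (auto simp: \<delta>_def)
  have \<delta>_le: "\<delta> \<le> d s" if "s \<in> S" for s using \<open>finite S\<close> that by (auto simp: \<delta>_def)
  have "\<delta> * cmod (c i) \<le> ?f c" if i: "i \<in> S" for c i
  proof -
    have "Max ((\<lambda>s. cmod (c s)) ` S) \<in> (\<lambda>s. cmod (c s)) ` S"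
      by (rule Max_in) (use \<open>finite S\<close> i in auto)
    then obtain s where s: "s \<in> S" "Max ((\<lambda>s. cmod (c s)) ` S) = cmod (c s)" by auto
    then have mx: "cmod (c j) \<le> cmod (c s)" if "j \<in> S" for j
      using Max_ge[of "(\<lambda>s. cmod (c s)) ` S" "cmod (c j)"] \<open>finite S\<close> that by auto
    show ?thesis
    proof (cases "c s = 0")
      case True
      then show ?thesis using mx[OF i] by simp
    next
      case False
      define c' where "c' j = (if j \<in> S then c j / c s else 0)" for j
      have "c' \<in> K s"
        using False mx s(1) by (auto simp: K_def PiE_def c'_def norm_divide divide_le_eq)
      then have "d s \<le> ?f c'" by (rule d(2)[OF s(1)])
      also have "(\<Sum>j\<in>S. c' j *\<^sub>C j) = (1 / c s) *\<^sub>C (\<Sum>j\<in>S. c j *\<^sub>C j)"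
        unfolding complex_vector.scale_sum_right by (rule sum.cong) (simp_all add: c'_def scaleC_scaleC)
      finally have "d s * cmod (c s) \<le> ?f c"
        using False by (simp add: norm_scaleC norm_divide field_simps)
      moreover have "\<delta> * cmod (c i) \<le> d s * cmod (c s)"
        using \<delta>_le[OF s(1)] mx[OF i] \<delta>0 by (intro mult_mono) auto
      ultimately show ?thesis by simp
    qed
  qed
  with \<delta>0 show ?thesis using that by blast
qed

text \<open>The coordinates with respect to a basis of a space containing the range are linear, and
  the norm equivalence makes them continuous functionals of the argument.\<close>

lemma finite_rank_ops_sum_rank_one:
  fixes T :: "'a::complex_normed_vector \<Rightarrow>\<^sub>L 'a"
  assumes "T \<in> finite_rank_ops"
  obtains S g where "finite S" "\<forall>s\<in>S. g s \<in> cblinfuns" "T = (\<Sum>s\<in>S. rank_one s (g s))"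
proof -
  obtain S0 where S0: "finite S0" "range (blinfun_apply T) \<subseteq> complex_vector.span S0" and T: "clinear (blinfun_apply T)"
    using assms by (auto simp: finite_rank_ops_def cblinfuns_def)
  obtain S where S: "S \<subseteq> S0" "\<not> complex_vector.dependent S" "S0 \<subseteq> complex_vector.span S"
    using complex_vector.maximal_independent_subset[of S0] by blast
  have fin: "finite S" using S(1) S0(1) finite_subset by blast
  have mem: "blinfun_apply T y \<in> complex_vector.span S" for y
    using S0(2) complex_vector.span_minimal[OF S(3)] complex_vector.subspace_span by blast
  obtain \<delta> where \<delta>: "\<delta> > 0" "\<And>c s. s \<in> S \<Longrightarrow> \<delta> * cmod (c s) \<le> norm (\<Sum>s\<in>S. c s *\<^sub>C s)"
    using finite_independent_norm_equivalence[OF fin S(2)] by blast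
  define h where "h s y = complex_vector.representation S (blinfun_apply T y) s" for s y
  have repr: "(\<Sum>s\<in>S. h s y *\<^sub>C s) = blinfun_apply T y" for y
    unfolding h_def by (rule complex_vector.sum_representation_eq[OF S(2) mem fin order_refl])
  have add: "h s (y + z) = h s y + h s z" for s y z
    using complex_vector.representation_add[OF S(2) mem mem] by (simp add: h_def blinfun.add_right)
  have scale: "h s (c *\<^sub>C y) = c * h s y" for s c y
    using complex_vector.representation_scale[OF S(2) mem, of c y] T by (simp add: h_def clinear_def)
  have "bounded_linear (h s)" if "s \<in> S" for s
  proof (rule bounded_linear_intro[of _ "norm T / \<delta>"])
    fix y
    have "\<delta> * cmod (h s y) \<le> norm T * norm y"
      using \<delta>(2)[OF that, of "\<lambda>s. h s y"] norm_blinfun[of T y] by (simp add: repr)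
    then show "norm (h s y) \<le> norm y * (norm T / \<delta>)"
      using \<delta>(1) by (simp add: field_simps)
  qed (simp_all add: add scale scaleR_scaleC scaleC_complex_def)
  then have app: "blinfun_apply (Blinfun (h s)) = h s" if "s \<in> S" for s
    using that by (simp add: bounded_linear_Blinfun_apply)
  show ?thesis
  proof
    show "\<forall>s\<in>S. Blinfun (h s) \<in> cblinfuns"
      by (simp add: cblinfuns_def clinear_def app add scale scaleC_complex_def)
    show "T = (\<Sum>s\<in>S. rank_one s (Blinfun (h s)))"
      by (rule blinfun_eqI) (simp add: blinfun.sum_left rank_one.rep_eq app flip: repr)
  qed (rule fin)
qed

lemma bounded_bilinear_rank_one:
  "bounded_bilinear (rank_one :: 'a::complex_normed_vector \<Rightarrow> _)"
proof
  show "\<exists>K. \<forall>(x::'a) f. norm (rank_one x f) \<le> norm x * norm f * K"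
  proof (intro exI allI, rule norm_blinfun_bound)
    fix x y :: 'a and f :: "'a \<Rightarrow>\<^sub>L complex"
    show "norm (blinfun_apply (rank_one x f) y) \<le> norm x * norm f * 1 * norm y"
      using mult_right_mono[OF norm_blinfun[of f y] norm_ge_zero[of x]]
      by (simp add: rank_one.rep_eq norm_scaleC mult_ac)
  qed simp
qed (rule blinfun_eqI, simp add: rank_one.rep_eq blinfun.add_left blinfun.scaleR_left scaleC_add_right
    scaleC_add_left scaleR_scaleC[where 'a = 'a] scaleC_scaleC scaleR_conv_of_real mult.commute)+

text \<open>An approximation argument: equi-Lipschitz maps that converge to the identity on a set do
  so on its closure.\<close>

lemma tendsto_closure_equibounded:
  fixes \<Phi> :: "'l \<Rightarrow> 'v::real_normed_vector \<Rightarrow> 'v"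
  assumes v: "v \<in> closure S" and C: "C \<ge> 0"
    and bd: "\<forall>\<^sub>F l in F. \<forall>u w. norm (\<Phi> l u - \<Phi> l w) \<le> C * norm (u - w)"
    and lim: "\<And>u. u \<in> S \<Longrightarrow> ((\<lambda>l. \<Phi> l u) \<longlongrightarrow> u) F"
  shows "((\<lambda>l. \<Phi> l v) \<longlongrightarrow> v) F"
proof (rule tendstoI)
  fix \<eta> :: real assume \<eta>: "\<eta> > 0"
  with C have "\<eta> / (2 * (C + 1)) > 0" by simp
  then obtain u where u: "u \<in> S" "dist u v < \<eta> / (2 * (C + 1))"
    using v unfolding closure_approachable by blast
  have "\<forall>\<^sub>F l in F. dist (\<Phi> l u) u < \<eta> / 2"
    using lim[OF u(1)] \<eta> by (intro tendstoD) auto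
  then show "\<forall>\<^sub>F l in F. dist (\<Phi> l v) v < \<eta>"
    using bd
  proof eventually_elim
    case (elim l)
    have "dist (\<Phi> l v) v \<le> dist (\<Phi> l v) (\<Phi> l u) + dist (\<Phi> l u) u + dist u v"
      by metric
    also have "dist (\<Phi> l v) (\<Phi> l u) \<le> C * dist u v"
      using elim(2) by (metis dist_commute dist_norm)
    also have "C * dist u v + dist (\<Phi> l u) u + dist u v = (C + 1) * dist u v + dist (\<Phi> l u) u"
      by (simp add: algebra_simps)
    also have "\<dots> < \<eta> / 2 + \<eta> / 2"
      using u(2) C elim(1) by (intro add_strict_mono) (auto simp: field_simps)
    finally show ?case by simp
  qed
qed

text \<open>On a rank-one operator, composing with \<open>E l\<close> on the left acts on the vector
  and on the right acts on the functional. Pointwise convergence on the space and on its dual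
  therefore suffices for finite rank, and the bound \<open>C\<close> carries it to the
  closure.\<close>

lemma approximable_ops_approximate_identity:
  fixes E :: "'l \<Rightarrow> 'a::cbanach \<Rightarrow>\<^sub>L 'a"
  assumes T: "T \<in> approximable_ops" and C: "C \<ge> 0"
    and bd: "\<forall>\<^sub>F l in F. norm (E l) \<le> C" and E: "\<forall>\<^sub>F l in F. E l \<in> cblinfuns"
    and left: "\<And>y. ((\<lambda>l. blinfun_apply (E l) y) \<longlongrightarrow> y) F"
    and right: "\<And>f :: 'a \<Rightarrow>\<^sub>L complex. f \<in> cblinfuns \<Longrightarrow> ((\<lambda>l. f o\<^sub>L E l) \<longlongrightarrow> f) F"
  shows "((\<lambda>l. E l o\<^sub>L T) \<longlongrightarrow> T) F" "((\<lambda>l. T o\<^sub>L E l) \<longlongrightarrow> T) F"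
    "((\<lambda>l. E l o\<^sub>L T o\<^sub>L E l) \<longlongrightarrow> T) F"
proof -
  interpret comp: bounded_bilinear "(o\<^sub>L) :: ('a \<Rightarrow>\<^sub>L 'a) \<Rightarrow> ('a \<Rightarrow>\<^sub>L 'a) \<Rightarrow> _"
    by (rule bounded_bilinear_blinfun_compose)
  interpret R: bounded_bilinear "rank_one :: 'a \<Rightarrow> _" by (rule bounded_bilinear_rank_one)
  show 1: "((\<lambda>l. E l o\<^sub>L T) \<longlongrightarrow> T) F"
  proof (rule tendsto_closure_equibounded[OF T[unfolded approximable_ops_def] C])
    show "\<forall>\<^sub>F l in F. \<forall>u w :: 'a \<Rightarrow>\<^sub>L 'a. norm ((E l o\<^sub>L u) - (E l o\<^sub>L w)) \<le> C * norm (u - w)"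
      using bd
    proof (rule eventually_mono, intro allI)
      fix l and u w :: "'a \<Rightarrow>\<^sub>L 'a" assume "norm (E l) \<le> C"
      then show "norm ((E l o\<^sub>L u) - (E l o\<^sub>L w)) \<le> C * norm (u - w)"
        unfolding comp.diff_right[symmetric]
        by (rule order_trans[OF norm_blinfun_compose mult_right_mono]) simp
    qed
    fix u :: "'a \<Rightarrow>\<^sub>L 'a" assume "u \<in> finite_rank_ops"
    then obtain S g where Sg: "finite S" "\<forall>s\<in>S. g s \<in> cblinfuns" "u = (\<Sum>s\<in>S. rank_one s (g s))"
      by (rule finite_rank_ops_sum_rank_one)
    have "((\<lambda>l. \<Sum>s\<in>S. rank_one (blinfun_apply (E l) s) (g s)) \<longlongrightarrow> u) F"
      unfolding Sg(3) by (intro tendsto_sum R.tendsto left tendsto_const)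
    moreover have "\<forall>\<^sub>F l in F. (\<Sum>s\<in>S. rank_one (blinfun_apply (E l) s) (g s)) = E l o\<^sub>L u"
      using E by (rule eventually_mono) (auto intro!: blinfun_eqI simp: Sg(3) blinfun.sum_left
          blinfun.sum_right rank_one.rep_eq cblinfuns_def clinear_def)
    ultimately show "((\<lambda>l. E l o\<^sub>L u) \<longlongrightarrow> u) F" by (rule Lim_transform_eventually)
  qed
  show 2: "((\<lambda>l. T o\<^sub>L E l) \<longlongrightarrow> T) F"
  proof (rule tendsto_closure_equibounded[OF T[unfolded approximable_ops_def] C])
    show "\<forall>\<^sub>F l in F. \<forall>u w :: 'a \<Rightarrow>\<^sub>L 'a. norm ((u o\<^sub>L E l) - (w o\<^sub>L E l)) \<le> C * norm (u - w)"
      using bd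
    proof (rule eventually_mono, intro allI)
      fix l and u w :: "'a \<Rightarrow>\<^sub>L 'a" assume "norm (E l) \<le> C"
      then show "norm ((u o\<^sub>L E l) - (w o\<^sub>L E l)) \<le> C * norm (u - w)"
        unfolding comp.diff_left[symmetric] mult.commute[of C]
        by (rule order_trans[OF norm_blinfun_compose mult_left_mono]) simp
    qed
    fix u :: "'a \<Rightarrow>\<^sub>L 'a" assume "u \<in> finite_rank_ops"
    then obtain S g where Sg: "finite S" "\<forall>s\<in>S. g s \<in> cblinfuns" "u = (\<Sum>s\<in>S. rank_one s (g s))"
      by (rule finite_rank_ops_sum_rank_one)
    have "((\<lambda>l. \<Sum>s\<in>S. rank_one s (g s o\<^sub>L E l)) \<longlongrightarrow> u) F"
      unfolding Sg(3) by (intro tendsto_sum R.tendsto right[OF bspec[OF Sg(2)]] tendsto_const)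
    moreover have "(\<Sum>s\<in>S. rank_one s (g s o\<^sub>L E l)) = u o\<^sub>L E l" for l
      by (auto intro!: blinfun_eqI simp: Sg(3) blinfun.sum_left rank_one.rep_eq)
    ultimately show "((\<lambda>l. u o\<^sub>L E l) \<longlongrightarrow> u) F" by simp
  qed
  \<comment> \<open>The two-sided limit splits as \<open>E T + E (T E - T)\<close>; boundedness of
    \<open>E\<close> makes the second term vanish.\<close>
  have "((\<lambda>l. E l o\<^sub>L ((T o\<^sub>L E l) - T)) \<longlongrightarrow> 0) F"
  proof (rule Lim_null_comparison)
    show "\<forall>\<^sub>F l in F. norm (E l o\<^sub>L ((T o\<^sub>L E l) - T)) \<le> C * norm ((T o\<^sub>L E l) - T)"
      using bd by (rule eventually_mono)
        (rule order_trans[OF norm_blinfun_compose mult_right_mono], simp_all)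
    show "((\<lambda>l. C * norm ((T o\<^sub>L E l) - T)) \<longlongrightarrow> 0) F"
      using tendsto_mult_right_zero[OF tendsto_norm_zero[OF LIM_zero[OF 2]]] .
  qed
  moreover have "E l o\<^sub>L T o\<^sub>L E l = E l o\<^sub>L (T o\<^sub>L E l)" for l
    by (rule blinfun_eqI) simp
  ultimately show "((\<lambda>l. E l o\<^sub>L T o\<^sub>L E l) \<longlongrightarrow> T) F"
    using tendsto_add[OF _ 1] by (fastforce simp: comp.diff_right)
qed

section \<open>Matrices acting through a biorthogonal system\<close>

lemma matrix_hom_apply:
  "blinfun_apply (matrix_hom n x \<phi> a) y = (\<Sum>j<n. (\<Sum>k<n. a $$ (j, k) * blinfun_apply (\<phi> k) y) *\<^sub>C x j)"
  by (simp add: matrix_hom_def blinfun.sum_left scaleC_blinfun.rep_eq rank_one.rep_eq scaleC_scaleC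
      complex_vector.scale_sum_left)

lemma matrix_hom_finite_rank:
  assumes "biorthogonal_system n x \<phi>"
  shows "matrix_hom n x \<phi> a \<in> finite_rank_ops"
proof -
  have lin: "blinfun_apply (\<phi> k) (y + z) = blinfun_apply (\<phi> k) y + blinfun_apply (\<phi> k) z"
    "blinfun_apply (\<phi> k) (c *\<^sub>C y) = c * blinfun_apply (\<phi> k) y" if "k < n" for k y z c
    using assms that by (auto simp: biorthogonal_system_def cblinfuns_def clinear_def scaleC_complex_def)
  have "clinear (blinfun_apply (matrix_hom n x \<phi> a))"
    by (simp add: clinear_def matrix_hom_apply lin sum.distrib distrib_left scaleC_add_left
        complex_vector.scale_sum_right scaleC_scaleC sum_distrib_left mult_ac)
  moreover have "range (blinfun_apply (matrix_hom n x \<phi> a)) \<subseteq> complex_vector.span (x ` {..<n})"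
    by (auto simp: matrix_hom_apply intro!: complex_vector.span_sum complex_vector.span_scale
        intro: complex_vector.span_base)
  ultimately show ?thesis
    unfolding finite_rank_ops_def cblinfuns_def by blast
qed

text \<open>Biorthogonality isolates the \<open>i\<close>-th coordinate: in the coordinates
  \<open>\<phi>\<close>, the operator acts as the matrix \<open>a\<close>, which makes the map
  multiplicative.\<close>

lemma functional_matrix_hom:
  assumes "biorthogonal_system n x \<phi>" "i < n"
  shows "blinfun_apply (\<phi> i) (blinfun_apply (matrix_hom n x \<phi> a) y)
    = (\<Sum>k<n. a $$ (i, k) * blinfun_apply (\<phi> k) y)"
proof -
  have sc: "blinfun_apply (\<phi> i) (c *\<^sub>C z) = c * blinfun_apply (\<phi> i) z" for c z
    using assms by (auto simp: biorthogonal_system_def cblinfuns_def clinear_def scaleC_complex_def)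
  have "blinfun_apply (\<phi> i) (blinfun_apply (matrix_hom n x \<phi> a) y)
    = (\<Sum>j<n. if j = i then \<Sum>k<n. a $$ (j, k) * blinfun_apply (\<phi> k) y else 0)"
    unfolding matrix_hom_apply blinfun.sum_right
    by (rule sum.cong) (use assms in \<open>auto simp: sc biorthogonal_system_def\<close>)
  then show ?thesis using assms(2) by simp
qed

lemma matrix_hom_mult:
  assumes bi: "biorthogonal_system n x \<phi>" and st: "s \<in> carrier_mat n n" "t \<in> carrier_mat n n"
  shows "matrix_hom n x \<phi> (s * t) = matrix_hom n x \<phi> s o\<^sub>L matrix_hom n x \<phi> t"
proof (rule blinfun_eqI)
  fix y
  have "(\<Sum>k<n. (s * t) $$ (j, k) * blinfun_apply (\<phi> k) y)
    = (\<Sum>i<n. s $$ (j, i) * (\<Sum>k<n. t $$ (i, k) * blinfun_apply (\<phi> k) y))" if "j < n" for j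
  proof -
    have "(s * t) $$ (j, k) = (\<Sum>i<n. s $$ (j, i) * t $$ (i, k))" if "k < n" for k
      using st that \<open>j < n\<close> by (simp add: scalar_prod_def lessThan_atLeast0)
    then have "(\<Sum>k<n. (s * t) $$ (j, k) * blinfun_apply (\<phi> k) y)
      = (\<Sum>k<n. \<Sum>i<n. s $$ (j, i) * (t $$ (i, k) * blinfun_apply (\<phi> k) y))"
      by (simp add: sum_distrib_right mult.assoc)
    also have "\<dots> = (\<Sum>i<n. s $$ (j, i) * (\<Sum>k<n. t $$ (i, k) * blinfun_apply (\<phi> k) y))"
      by (subst sum.swap) (simp add: sum_distrib_left)
    finally show ?thesis .
  qed
  then show "blinfun_apply (matrix_hom n x \<phi> (s * t)) y
    = blinfun_apply (matrix_hom n x \<phi> s o\<^sub>L matrix_hom n x \<phi> t) y"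
    by (simp add: matrix_hom_apply[of _ _ _ "s * t"] matrix_hom_apply[of _ _ _ s]
        functional_matrix_hom[OF bi])
qed

text \<open>Every corner of a complex-linear operator comes from a matrix, and so lies in the span
  of the images of the group.\<close>

lemma matrix_hom_compress:
  assumes bi: "biorthogonal_system n x \<phi>" and T: "T \<in> cblinfuns"
  shows "matrix_hom n x \<phi> (1\<^sub>m n) o\<^sub>L T o\<^sub>L matrix_hom n x \<phi> (1\<^sub>m n)
    = matrix_hom n x \<phi> (mat n n (\<lambda>(j, k). blinfun_apply (\<phi> j) (blinfun_apply T (x k))))"
proof (rule blinfun_eqI)
  fix y
  have id: "blinfun_apply (matrix_hom n x \<phi> (1\<^sub>m n)) y = (\<Sum>j<n. blinfun_apply (\<phi> j) y *\<^sub>C x j)" for y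
  proof -
    have "(\<Sum>k<n. 1\<^sub>m n $$ (j, k) * blinfun_apply (\<phi> k) y) = blinfun_apply (\<phi> j) y" if "j < n" for j
    proof -
      have "(\<Sum>k<n. 1\<^sub>m n $$ (j, k) * blinfun_apply (\<phi> k) y) = (\<Sum>k<n. if k = j then blinfun_apply (\<phi> k) y else 0)"
        by (rule sum.cong) (use that in auto)
      then show ?thesis using that by simp
    qed
    then show ?thesis by (simp add: matrix_hom_apply)
  qed
  have scT: "blinfun_apply T (c *\<^sub>C z) = c *\<^sub>C blinfun_apply T z" for c z
    using T by (simp add: cblinfuns_def clinear_def)
  have sc: "blinfun_apply (\<phi> j) (c *\<^sub>C z) = c * blinfun_apply (\<phi> j) z" if "j < n" for j c z
    using bi that by (auto simp: biorthogonal_system_def cblinfuns_def clinear_def scaleC_complex_def)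
  show "blinfun_apply (matrix_hom n x \<phi> (1\<^sub>m n) o\<^sub>L T o\<^sub>L matrix_hom n x \<phi> (1\<^sub>m n)) y
    = blinfun_apply (matrix_hom n x \<phi> (mat n n (\<lambda>(j, k). blinfun_apply (\<phi> j) (blinfun_apply T (x k))))) y"
    by (simp add: id matrix_hom_apply[of _ _ _ "mat n n _"] blinfun.sum_right scT sc
        complex_vector.scale_sum_left scaleC_scaleC mult.commute) (rule sum.swap)
qed

lemma matrix_hom_span:
  assumes "spans_matrices n G" "a \<in> carrier_mat n n"
  obtains c where "matrix_hom n x \<phi> a = (\<Sum>t\<in>G. c t *\<^sub>C matrix_hom n x \<phi> t)"
proof -
  obtain c where c: "\<forall>j<n. \<forall>k<n. a $$ (j, k) = (\<Sum>t\<in>G. c t * t $$ (j, k))"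
    using assms unfolding spans_matrices_def by blast
  have "matrix_hom n x \<phi> a = (\<Sum>j<n. \<Sum>k<n. \<Sum>t\<in>G. c t *\<^sub>C (t $$ (j, k) *\<^sub>C rank_one (x j) (\<phi> k)))"
    unfolding matrix_hom_def
    by (intro sum.cong refl) (simp add: c complex_vector.scale_sum_left scaleC_scaleC)
  also have "\<dots> = (\<Sum>j<n. \<Sum>t\<in>G. \<Sum>k<n. c t *\<^sub>C (t $$ (j, k) *\<^sub>C rank_one (x j) (\<phi> k)))"
    by (rule sum.cong[OF refl], rule sum.swap)
  also have "\<dots> = (\<Sum>t\<in>G. \<Sum>j<n. \<Sum>k<n. c t *\<^sub>C (t $$ (j, k) *\<^sub>C rank_one (x j) (\<phi> k)))"
    by (rule sum.swap)
  also have "\<dots> = (\<Sum>t\<in>G. c t *\<^sub>C matrix_hom n x \<phi> t)"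
    unfolding matrix_hom_def complex_vector.scale_sum_right ..
  finally show ?thesis by (rule that)
qed

section \<open>From property (A) to the constant for approximable operators\<close>

lemma approx_op_sum: "approx_op (\<Sum>i\<in>I. f i) = (\<Sum>i\<in>I. approx_op (f i))"
  by (induction I rule: infinite_finite_induct) (simp_all add: zero_approximable.rep_eq plus_approximable.rep_eq)

lemma tendsto_approx_op_iff: "(f \<longlongrightarrow> T) F \<longleftrightarrow> ((\<lambda>l. approx_op (f l)) \<longlongrightarrow> approx_op T) F"
  by (simp add: tendsto_iff dist_norm norm_approximable.rep_eq minus_approximable.rep_eq)

lemma GL_simps:
  "mult (GL n) = (*)" "one (GL n) = 1\<^sub>m n" "carrier (GL n) \<subseteq> carrier_mat n n" "group (GL n)"
proof -
  interpret ring "ring_mat TYPE(complex) n ()" by (rule ring_mat)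
  show "mult (GL n) = (*)" "one (GL n) = 1\<^sub>m n"
    by (simp_all add: GL_def units_of_mult units_of_one ring_mat_simps)
  show "carrier (GL n) \<subseteq> carrier_mat n n"
    by (auto simp: GL_def units_of_carrier Units_def ring_mat_simps)
  show "group (GL n)" unfolding GL_def by (rule units_group)
qed

lemma property_A_szpd_const:
  fixes x :: "'l \<Rightarrow> nat \<Rightarrow> 'a::cbanach"
  assumes A: "property_A_data \<Lambda> preceq n x \<phi> G"
    and C: "C = (SUP l\<in>\<Lambda>. SUP t\<in>G l. norm (matrix_hom (n l) (x l) (\<phi> l) t))"
  shows "300 * C\<^sup>2 \<in> szpd_consts TYPE('a approximable)"
proof -
  define hom where "hom l = matrix_hom (n l) (x l) (\<phi> l)" for l
  define F where "F = net_filter \<Lambda> preceq"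
  have dir: "directed_set \<Lambda> preceq" and bi: "\<And>l. l \<in> \<Lambda> \<Longrightarrow> biorthogonal_system (n l) (x l) (\<phi> l)"
    and limK: "\<And>K :: 'a set. compact K \<Longrightarrow> uniform_limit K (\<lambda>l y. hom l (1\<^sub>m (n l)) y) (\<lambda>y. y) F"
    and limK': "\<And>K :: ('a \<Rightarrow>\<^sub>L complex) set. K \<subseteq> cblinfuns \<Longrightarrow> compact K \<Longrightarrow>
      uniform_limit K (\<lambda>l f. f o\<^sub>L hom l (1\<^sub>m (n l))) (\<lambda>f. f) F"
    and fin: "\<And>l. l \<in> \<Lambda> \<Longrightarrow> finite (G l)" and sub: "\<And>l. l \<in> \<Lambda> \<Longrightarrow> subgroup (G l) (GL (n l))"
    and spans: "\<And>l. l \<in> \<Lambda> \<Longrightarrow> spans_matrices (n l) (G l)"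
    using A unfolding property_A_data_def hom_def F_def by blast+
  have bdd: "bdd_above ((\<lambda>l. SUP t\<in>G l. norm (hom l t)) ` \<Lambda>)"
    using A unfolding property_A_data_def hom_def by (elim conjE)
  have ev: "\<forall>\<^sub>F l in F. l \<in> \<Lambda>"
    unfolding F_def eventually_net_filter[OF dir] using dir unfolding directed_set_def by blast
  have F: "F \<noteq> bot"
    unfolding eventually_False[symmetric] F_def eventually_net_filter[OF dir]
    using dir unfolding directed_set_def by blast
  have bound: "norm (hom l t) \<le> C" if "l \<in> \<Lambda>" "t \<in> G l" for l t
  proof -
    have "norm (hom l t) \<le> (SUP t\<in>G l. norm (hom l t))"
      by (rule cSUP_upper) (use that fin in auto)
    also have "\<dots> \<le> C"
      unfolding C hom_def[symmetric] by (rule cSUP_upper[OF that(1) bdd])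
    finally show ?thesis .
  qed
  \<comment> \<open>Since the identity matrix belongs to the group, \<open>C\<close> also bounds the
    approximate identity.\<close>
  have one: "1\<^sub>m (n l) \<in> G l" if "l \<in> \<Lambda>" for l
    using subgroup.one_closed[OF sub[OF that]] by (simp add: GL_simps)
  have C0: "C \<ge> 0"
  proof -
    obtain l where "l \<in> \<Lambda>" using dir unfolding directed_set_def by blast
    then show ?thesis using bound[OF _ one] norm_ge_zero order_trans by blast
  qed
  \<comment> \<open>The abstraction is meaningful for \<open>l\<close> in \<open>\<Lambda>\<close>,
    where \<open>hom l t\<close> has finite rank; such indices occur eventually along the
    net.\<close>
  define \<tau> where "\<tau> l t = Abs_approximable (hom l t)" for l t
  have fr: "hom l t \<in> finite_rank_ops" if "l \<in> \<Lambda>" for l t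
    using matrix_hom_finite_rank[OF bi[OF that]] by (simp add: hom_def)
  then have "hom l t \<in> approximable_ops" if "l \<in> \<Lambda>" for l t
    using that closure_subset unfolding approximable_ops_def by blast
  then have \<tau>: "approx_op (\<tau> l t) = hom l t" if "l \<in> \<Lambda>" for l t
    using that by (simp add: \<tau>_def Abs_approximable_inverse)
  define H where "H l = GL (n l)\<lparr>carrier := G l\<rparr>" for l
  have H: "carrier (H l) = G l" "\<one>\<^bsub>H l\<^esub> = 1\<^sub>m (n l)" "mult (H l) = (*)" for l
    by (simp_all add: H_def GL_simps)
  have rep: "finite_group_rep (H l) (\<tau> l) C" if l: "l \<in> \<Lambda>" for l
  proof -
    interpret group "H l"
      unfolding H_def by (rule subgroup.subgroup_is_group[OF sub[OF l] GL_simps(4)])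
    have car: "G l \<subseteq> carrier_mat (n l) (n l)"
      using subgroup.subset[OF sub[OF l]] GL_simps(3) by blast
    show ?thesis
    proof
      show "\<tau> l (s \<otimes>\<^bsub>H l\<^esub> t) = \<tau> l s * \<tau> l t" if "s \<in> carrier (H l)" "t \<in> carrier (H l)" for s t
      proof -
        have "s \<in> carrier_mat (n l) (n l)" "t \<in> carrier_mat (n l) (n l)"
          using that car by (auto simp: H)
        from matrix_hom_mult[OF bi[OF l] this] show ?thesis
          by (simp add: H \<tau>[OF l] times_approximable.rep_eq hom_def flip: approx_op_inject)
      qed
    qed (use fin[OF l] bound[OF l] in \<open>auto simp: H \<tau>[OF l] norm_approximable.rep_eq\<close>)
  qed
  have bdE: "\<forall>\<^sub>F l in F. norm (hom l (1\<^sub>m (n l))) \<le> C"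
    using ev by (rule eventually_mono) (simp add: bound one)
  have cE: "\<forall>\<^sub>F l in F. hom l (1\<^sub>m (n l)) \<in> cblinfuns"
    using ev by (rule eventually_mono) (use fr finite_rank_ops_def in blast)
  \<comment> \<open>Singletons are compact, so the uniform limits yield pointwise convergence here
    and on the dual.\<close>
  have left: "((\<lambda>l. blinfun_apply (hom l (1\<^sub>m (n l))) y) \<longlongrightarrow> y) F" for y
    using tendsto_uniform_limitI[OF limK[of "{y}"]] by simp
  have right: "((\<lambda>l. f o\<^sub>L hom l (1\<^sub>m (n l))) \<longlongrightarrow> f) F" if "f \<in> cblinfuns" for f :: "'a \<Rightarrow>\<^sub>L complex"
    using tendsto_uniform_limitI[OF limK'[of "{f}"]] that by simp
  show ?thesis
  proof (rule szpd_const_of_finite_group_reps[OF F C0, of H \<tau>])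
    show "\<forall>\<^sub>F l in F. finite_group_rep (H l) (\<tau> l) C"
      using ev by (rule eventually_mono) (rule rep)
    fix b :: "'a approximable"
    note lims = approximable_ops_approximate_identity[OF approx_op[of b] C0 bdE cE left right]
    have "\<forall>\<^sub>F l in F. approx_op b o\<^sub>L hom l (1\<^sub>m (n l)) = approx_op (b * \<tau> l \<one>\<^bsub>H l\<^esub>)"
      using ev by (rule eventually_mono) (simp add: H \<tau> times_approximable.rep_eq)
    with lims(2) show "((\<lambda>l. b * \<tau> l \<one>\<^bsub>H l\<^esub>) \<longlongrightarrow> b) F"
      unfolding tendsto_approx_op_iff by (rule Lim_transform_eventually)
    have eb: "approx_op (\<tau> l \<one>\<^bsub>H l\<^esub> * b * \<tau> l \<one>\<^bsub>H l\<^esub>) = hom l (1\<^sub>m (n l)) o\<^sub>L approx_op b o\<^sub>L hom l (1\<^sub>m (n l))"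
      if "l \<in> \<Lambda>" for l
      using that by (simp add: H \<tau> times_approximable.rep_eq)
    have "\<forall>\<^sub>F l in F. hom l (1\<^sub>m (n l)) o\<^sub>L approx_op b o\<^sub>L hom l (1\<^sub>m (n l)) = approx_op (\<tau> l \<one>\<^bsub>H l\<^esub> * b * \<tau> l \<one>\<^bsub>H l\<^esub>)"
      using ev by (rule eventually_mono) (simp add: eb)
    with lims(3) show "((\<lambda>l. \<tau> l \<one>\<^bsub>H l\<^esub> * b * \<tau> l \<one>\<^bsub>H l\<^esub>) \<longlongrightarrow> b) F"
      unfolding tendsto_approx_op_iff by (rule Lim_transform_eventually)
    show "\<forall>\<^sub>F l in F. \<exists>c. \<tau> l \<one>\<^bsub>H l\<^esub> * b * \<tau> l \<one>\<^bsub>H l\<^esub> = (\<Sum>s\<in>carrier (H l). c s *\<^sub>C \<tau> l s)"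
      using ev
    proof (rule eventually_mono)
      fix l assume l: "l \<in> \<Lambda>"
      have "approx_op b \<in> cblinfuns" using approx_op approximable_ops_subset by blast
      from matrix_hom_compress[OF bi[OF l] this]
      obtain a where a: "a \<in> carrier_mat (n l) (n l)"
        "hom l (1\<^sub>m (n l)) o\<^sub>L approx_op b o\<^sub>L hom l (1\<^sub>m (n l)) = hom l a"
        unfolding hom_def by (metis mat_carrier)
      obtain c where "hom l a = (\<Sum>t\<in>G l. c t *\<^sub>C hom l t)"
        using matrix_hom_span[OF spans[OF l] a(1)] unfolding hom_def by blast
      then have "\<tau> l \<one>\<^bsub>H l\<^esub> * b * \<tau> l \<one>\<^bsub>H l\<^esub> = (\<Sum>s\<in>carrier (H l). c s *\<^sub>C \<tau> l s)"
        unfolding approx_op_inject[symmetric] eb[OF l] a(2)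
        by (simp add: approx_op_sum scaleC_approximable.rep_eq H \<tau>[OF l])
      then show "\<exists>c. \<tau> l \<one>\<^bsub>H l\<^esub> * b * \<tau> l \<one>\<^bsub>H l\<^esub> = (\<Sum>s\<in>carrier (H l). c s *\<^sub>C \<tau> l s)" by (rule exI[of _ c])
    qed
  qed
qed

text \<open>As \<open>sin (pi / 10) < sin (pi / 6) = 1 / 2\<close>, the denominator is positive and
  the quotient is at least 1; with \<open>sqrt 27\<close> at least 5 the product is at least 60
  times 5.\<close>

lemma zero_product_constant_ge:
  "300 \<le> 60 * sqrt 27 * ((1 + sin (pi / 10)) / (1 - 2 * sin (pi / 10)))"
proof -
  have s: "0 \<le> sin (pi / 10)" by (intro sin_ge_zero) auto
  have "sin (pi / 10) < sin (pi / 6)" by (rule sin_monotone_2pi) (use pi_gt_zero in auto)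
  then have s': "sin (pi / 10) < 1 / 2" by (simp add: sin_30)
  have "1 \<le> (1 + sin (pi / 10)) / (1 - 2 * sin (pi / 10))"
    using s s' by (simp add: field_simps)
  moreover have "5 \<le> sqrt 27" by (rule real_le_rsqrt) simp
  ultimately have "60 * 5 * 1 \<le> 60 * sqrt 27 * ((1 + sin (pi / 10)) / (1 - 2 * sin (pi / 10)))"
    by (intro mult_mono) auto
  then show ?thesis by simp
qed

theorem theorem4p1:
  fixes \<Lambda> :: "'l set" and preceq :: "'l \<Rightarrow> 'l \<Rightarrow> bool" and n :: "'l \<Rightarrow> nat"
    and x :: "'l \<Rightarrow> nat \<Rightarrow> 'a::cbanach" and \<phi> :: "'l \<Rightarrow> nat \<Rightarrow> 'a \<Rightarrow>\<^sub>L complex"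
    and G :: "'l \<Rightarrow> complex mat set" and C :: real
  assumes "property_A_data \<Lambda> preceq n x \<phi> G"
    and "C = (SUP l\<in>\<Lambda>. SUP t\<in>G l. norm (matrix_hom (n l) (x l) (\<phi> l) t))"
  shows "strongly_zero_product_determined TYPE('a approximable)
    \<and> strong_property_B TYPE('a approximable)
    \<and> (1 / 2) * beta_const TYPE('a approximable) \<le> alpha_const TYPE('a approximable)
    \<and> alpha_const TYPE('a approximable)
        \<le> 60 * sqrt 27 * ((1 + sin (pi / 10)) / (1 - 2 * sin (pi / 10))) * C\<^sup>2"
proof (intro conjI)
  have mem: "300 * C\<^sup>2 \<in> szpd_consts TYPE('a approximable)"
    by (rule property_A_szpd_const[OF assms])
  then show szpd: "strongly_zero_product_determined TYPE('a approximable)"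
    unfolding strongly_zero_product_determined_def by blast
  show "strong_property_B TYPE('a approximable)"
    "(1 / 2) * beta_const TYPE('a approximable) \<le> alpha_const TYPE('a approximable)"
    by (rule half_beta_const_le_alpha_const[OF szpd])+
  have "alpha_const TYPE('a approximable) \<le> 300 * C\<^sup>2"
    unfolding alpha_const_def
    by (rule cInf_lower[OF mem]) (auto simp: szpd_consts_def intro!: bdd_belowI[of _ 0])
  also have "\<dots> \<le> 60 * sqrt 27 * ((1 + sin (pi / 10)) / (1 - 2 * sin (pi / 10))) * C\<^sup>2"
    by (rule mult_right_mono[OF zero_product_constant_ge]) simp
  finally show "alpha_const TYPE('a approximable)
      \<le> 60 * sqrt 27 * ((1 + sin (pi / 10)) / (1 - 2 * sin (pi / 10))) * C\<^sup>2" .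
qed

end
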